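(* Let $\triangle PQR$ be a triangle contained in $D$ with $\rho(\psi_{\triangle PQR})=\frac13$; write $\psi=\psi_{\triangle PQR}$. (1) If $\delta(P,Q,R)=\Delta'(P,Q)$: there exists $u_1\in S^1$ with $\psi^3(u_1)=u_1$ such that, setting $u_2=\psi(u_1)$, $u_3=\psi^2(u_1)$, $I_1=\mathrm{arc}(u_3u_1)\setminus\{u_3\}$ and $I_j=\mathrm{arc}(u_{j-1}u_j)\setminus\{u_{j-1}\}$ for $j=2,3$, we have $\lim_{n\to\infty}\psi^{3n}(v)=u_j$ for every $j\in\{1,2,3\}$ and every $v\in I_j$. (2) If $\delta(P,Q,R)>\Delta'(P,Q)$: there exist $u_1\in S^1$ with $\psi^3(u_1)=u_1$ and, with $u_2=\psi(u_1)$, $u_3=\psi^2(u_1)$, a point $v_1\in\mathrm{arc}(u_1u_2)\setminus\{u_1,u_2\}$ with $\psi^3(v_1)=v_1$, such that, setting $v_2=\psi(v_1)$, $v_3=\psi^2(v_1)$, $I_1'=\mathrm{arc}(v_3v_1)\setminus\{v_3,v_1\}$ and $I_j'=\mathrm{arc}(v_{j-1}v_j)\setminus\{v_{j-1},v_j\}$ for $j=2,3$, we have $\lim_{n\to\infty}\psi^{3n}(v)=u_j$ for every $j\in\{1,2,3\}$ and every $v\in I_j'$.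
   Context: $D$ is the open unit disk in $\mathbb{R}^2$ (Beltrami–Klein model) and $S^1$ its boundary, identified with $\mathbb{R}/\mathbb{Z}$ via $t\mapsto(\cos2\pi t,\sin2\pi t)$. For $u,v\in S^1$, $\mathrm{arc}(uv)$ is the closed arc of $S^1$ going counterclockwise from $u$ to $v$. For $P,Q\in D$ with chord endpoints $v_1,v_2\in S^1$, $d'(P,Q)=\frac12\left|\log\frac{|v_1Q||v_2P|}{|v_1P||v_2Q|}\right|$, $\Delta'(P,Q)=\log\frac{e^{d'(P,Q)}+1}{e^{d'(P,Q)}-1}$, and $\delta(P,Q,R)$ is the minimum of $d'(R,S)$ over points $S\in D$ on the line $PQ$. For a (non-degenerate, closed) triangle $\triangle PQR\subset D$ and $v\in S^1$, there are exactly two chords $vv_1,vv_2$ of $S^1$ whose lines support $\triangle PQR$; with $v_1$ the one reached first moving counterclockwise from $v$, set $\psi_{\triangle PQR}(v):=v_1$ (a homeomorphism of $S^1$). $\rho(\psi_{\triangle PQR})=\lim_{n\to\infty}\overline{\psi}^{\,n}(0)/n$ is its rotation number, where $\overline{\psi}$ is the lift to $\mathbb{R}$ with $\overline{\psi}(0)\in(0,1)$. *)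

theory Defs
  imports "HOL-Analysis.Analysis"
begin

text \<open>The plane R^2 is modelled by the complex numbers (x,y) = x + i y.\<close>

definition diskD :: "complex set" where "diskD = ball 0 1"
definition circleS :: "complex set" where "circleS = sphere 0 1"

definition circ :: "real \<Rightarrow> complex" where "circ t = cis (2 * pi * t)"

definition ccw_dist :: "complex \<Rightarrow> complex \<Rightarrow> real" where
  "ccw_dist u w = frac ((Arg w - Arg u) / (2 * pi))"

definition ccw_arc :: "complex \<Rightarrow> complex \<Rightarrow> complex set" where
  "ccw_arc u v = {w \<in> circleS. ccw_dist u w \<le> ccw_dist u v}"

text \<open>The metric d'(P,Q) defined via the chord endpoints v1, v2 of the line PQ
  (the value does not depend on the labelling of the endpoints).\<close>
definition dprime :: "complex \<Rightarrow> complex \<Rightarrow> real" where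
  "dprime P Q = (THE d. \<exists>v1 v2. v1 \<in> circleS \<and> v2 \<in> circleS \<and> v1 \<noteq> v2 \<and>
      collinear {P, Q, v1} \<and> collinear {P, Q, v2} \<and>
      d = (1/2) * \<bar>ln ((dist v1 Q * dist v2 P) / (dist v1 P * dist v2 Q))\<bar>)"

definition Deltaprime :: "complex \<Rightarrow> complex \<Rightarrow> real" where
  "Deltaprime P Q = ln ((exp (dprime P Q) + 1) / (exp (dprime P Q) - 1))"

definition delta :: "complex \<Rightarrow> complex \<Rightarrow> complex \<Rightarrow> real" where
  "delta P Q R = Inf {dprime R S | S. S \<in> diskD \<and> collinear {P, Q, S}}"

definition cross2 :: "complex \<Rightarrow> complex \<Rightarrow> real" where
  "cross2 a b = Im (cnj a * b)"

definition supports_chord :: "complex \<Rightarrow> complex \<Rightarrow> complex set \<Rightarrow> bool" where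
  "supports_chord v w T \<longleftrightarrow> w \<in> circleS \<and> w \<noteq> v \<and>
     (\<exists>x\<in>T. cross2 (w - v) (x - v) = 0) \<and>
     ((\<forall>x\<in>T. cross2 (w - v) (x - v) \<ge> 0) \<or> (\<forall>x\<in>T. cross2 (w - v) (x - v) \<le> 0))"

definition tri_psi :: "complex \<Rightarrow> complex \<Rightarrow> complex \<Rightarrow> complex \<Rightarrow> complex" where
  "tri_psi P Q R v = (THE w. supports_chord v w (convex hull {P, Q, R}) \<and>
      (\<forall>w'. supports_chord v w' (convex hull {P, Q, R}) \<and> w' \<noteq> w \<longrightarrow>
            ccw_dist v w < ccw_dist v w'))"

definition is_lift :: "(complex \<Rightarrow> complex) \<Rightarrow> (real \<Rightarrow> real) \<Rightarrow> bool" where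
  "is_lift f F \<longleftrightarrow> continuous_on UNIV F \<and> (\<forall>t. circ (F t) = f (circ t)) \<and> F 0 \<in> {0<..<1}"

definition rotnum :: "(complex \<Rightarrow> complex) \<Rightarrow> real" where
  "rotnum f = (THE r. \<exists>F. is_lift f F \<and> (\<lambda>n. (F ^^ n) 0 / real n) \<longlonglongrightarrow> r)"

end

theory Submission
  imports Defs
begin

text \<open>
  Sending a point of the circle to the other endpoint of its chord through \<open>X\<close> is a hyperbolic
  half-turn about \<open>X\<close>. It has an explicit lift to the reals with values in \<open>(t, t + 1)\<close>, and \<open>\<psi>\<close> lifts to
  the minimum \<open>F\<close> of the lifts \<open>p\<close>, \<open>q\<close>, \<open>r\<close> belonging to the three vertices. If \<open>PQR\<close> is oriented
  counterclockwise, every 3-periodic orbit consists of the vertices of an inscribed triangle whose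
  sides pass through \<open>P\<close>, \<open>Q\<close>, \<open>R\<close> in this order, hence contains a fixed point of the Moebius map
  lifted by \<open>r \<circ> q \<circ> p\<close>. The fixed points of that map are the intersection of the circle with a line,
  whose discriminant has the sign of \<open>sinh\<^sup>2 d'(P,Q) sinh\<^sup>2 \<delta>(P,Q,R) - 1\<close>; since
  \<open>sinh \<Delta>'(P,Q) = 1 / sinh d'(P,Q)\<close>, there is one 3-periodic orbit if \<open>\<delta> = \<Delta>'\<close> and there are at most
  two if \<open>\<delta> > \<Delta>'\<close>. The map \<open>F\<^sup>3 - 1\<close> is above the identity where a support line contains the side
  \<open>PQ\<close>, and, in the second case, below the identity somewhere because \<open>F\<^sup>3 \<le> r \<circ> q \<circ> p\<close>. These signs
  leave only the semistable orbit and the alternating attracting and repelling orbits, respectively.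
\<close>

section \<open>Third iterates of circle maps\<close>

text \<open>The orbit of \<open>v\<close> increases to a limit at most \<open>y\<close>; by
  continuity the limit is a fixed point, and \<open>up\<close> leaves only \<open>y\<close>.\<close>

lemma iterates_tendsto_right_fixpoint:
  fixes g :: "real \<Rightarrow> real"
  assumes cont: "continuous_on UNIV g" and mono: "mono g" and fix_y: "g y = y"
    and up: "\<forall>c\<in>{x<..<y}. g c > c" and v: "x < v" "v \<le> y"
  shows "(\<lambda>n. (g ^^ n) v) \<longlonglongrightarrow> y"
proof -
  have le: "c \<le> g c" if "x < c" "c \<le> y" for c
    using bspec[OF up, of c] fix_y that by (cases "c = y") auto
  have bnd: "v \<le> (g ^^ n) v \<and> (g ^^ n) v \<le> y" for n
  proof (induction n)
    case (Suc n)
    have "(g ^^ n) v \<le> g ((g ^^ n) v)" using Suc v by (intro le) auto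
    moreover have "g ((g ^^ n) v) \<le> g y" using Suc mono by (auto dest: monoD)
    ultimately show ?case using Suc fix_y by auto
  qed (use v in auto)
  have inc: "incseq (\<lambda>n. (g ^^ n) v)"
    using bnd v by (intro incseq_SucI) (auto intro!: le elim: less_le_trans)
  obtain L where L: "(\<lambda>n. (g ^^ n) v) \<longlonglongrightarrow> L" "\<And>n. (g ^^ n) v \<le> L"
    using incseq_convergent[OF inc, of y] bnd by blast
  have "v \<le> L" using L(2)[of 0] by simp
  have "L \<le> y" using LIMSEQ_le_const2[OF L(1), of y] bnd by blast
  have "(\<lambda>n. g ((g ^^ n) v)) \<longlonglongrightarrow> g L"
    using cont L(1) by (intro isCont_tendsto_compose[of L g]) (auto simp: continuous_on_eq_continuous_at)
  moreover have "(\<lambda>n. g ((g ^^ n) v)) \<longlonglongrightarrow> L"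
    using LIMSEQ_Suc[OF L(1)] by simp
  ultimately have "g L = L" by (rule LIMSEQ_unique)
  then have "L = y" using bspec[OF up, of L] \<open>v \<le> L\<close> \<open>L \<le> y\<close> v by fastforce
  then show ?thesis using L(1) by simp
qed

lemma iterates_tendsto_left_fixpoint:
  fixes g :: "real \<Rightarrow> real"
  assumes cont: "continuous_on UNIV g" and mono: "mono g" and fix_x: "g x = x"
    and down: "\<forall>c\<in>{x<..<y}. g c < c" and v: "x \<le> v" "v < y"
  shows "(\<lambda>n. (g ^^ n) v) \<longlonglongrightarrow> x"
proof -
  \<comment> \<open>Reflection in the origin turns a decreasing orbit into an increasing
    one.\<close>
  define k where "k = (\<lambda>t. - g (- t))"
  have kn: "(k ^^ n) (- v) = - (g ^^ n) v" for n by (induction n) (auto simp: k_def)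
  have "continuous_on UNIV k" unfolding k_def
    by (intro continuous_intros continuous_on_compose2[OF cont]) auto
  moreover have "mono k" using mono by (auto simp: k_def mono_def)
  moreover have "k (- x) = - x" using fix_x by (simp add: k_def)
  moreover have "\<forall>c\<in>{- y<..<- x}. k c > c"
  proof
    fix c assume "c \<in> {- y<..<- x}"
    then show "k c > c" using bspec[OF down, of "- c"] by (simp add: k_def)
  qed
  ultimately have "(\<lambda>n. (k ^^ n) (- v)) \<longlonglongrightarrow> - x"
    using v by (intro iterates_tendsto_right_fixpoint[of k "- x" "- y"]) auto
  then show ?thesis unfolding kn by (simp add: tendsto_minus_cancel_left)
qed

text \<open>Intermediate value theorem for \<open>g t - t\<close>; \<open>min\<close> and
  \<open>max\<close> admit \<open>c\<close> and \<open>d\<close> in either order.\<close>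

lemma fixpoint_between:
  fixes g :: "real \<Rightarrow> real"
  assumes "continuous_on UNIV g" and "g c \<le> c \<and> d \<le> g d \<or> c \<le> g c \<and> g d \<le> d"
  shows "\<exists>z. min c d \<le> z \<and> z \<le> max c d \<and> g z = z"
proof -
  let ?k = "\<lambda>t. g t - t"
  have cont: "continuous_on {min c d..max c d} ?k"
    by (intro continuous_intros continuous_on_subset[OF assms(1)]) auto
  have "\<exists>z. min c d \<le> z \<and> z \<le> max c d \<and> ?k z = 0"
    using assms(2) IVT'[OF _ _ _ cont, of 0] IVT2'[OF _ _ _ cont, of 0]
    by (cases "c \<le> d") (auto simp: min_def max_def)
  then show ?thesis by auto
qed

lemma no_fixpoint_same_sign:
  fixes g :: "real \<Rightarrow> real"
  assumes cont: "continuous_on UNIV g"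
    and nofix: "\<forall>c\<in>{x<..<y}. g c \<noteq> c"
    and "x < c" "c < y" "x < d" "d < y"
  shows "g c < c \<longleftrightarrow> g d < d"
proof (rule ccontr)
  assume "\<not> (g c < c \<longleftrightarrow> g d < d)"
  then have "g c \<le> c \<and> d \<le> g d \<or> c \<le> g c \<and> g d \<le> d" by auto
  from fixpoint_between[OF cont this] obtain z where
    "min c d \<le> z" "z \<le> max c d" "g z = z" by blast
  then show False using bspec[OF nofix, of z] assms(3-6) by (auto simp: min_def max_def split: if_splits)
qed

section \<open>Lifts of circle homeomorphisms without fixed points\<close>

locale circle_lift =
  fixes F :: "real \<Rightarrow> real"
  assumes continuous: "continuous_on UNIV F"
    and strict_mono: "strict_mono F"
    and add_one: "\<And>t. F (t + 1) = F t + 1"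
    and greater: "\<And>t. F t > t"
begin

text \<open>Subtracting one full turn makes the fixed points of \<open>ret\<close> the lifts of
  orbits that close up after three steps and one turn.\<close>

definition ret :: "real \<Rightarrow> real" where
  "ret t = F (F (F t)) - 1"

lemma less_iff [simp]: "F s < F t \<longleftrightarrow> s < t"
  by (simp add: strict_mono strict_mono_less)

lemma le_iff [simp]: "F s \<le> F t \<longleftrightarrow> s \<le> t"
  by (simp add: strict_mono strict_mono_less_eq)

lemma eq_iff [simp]: "F s = F t \<longleftrightarrow> s = t"
  by (simp add: strict_mono strict_mono_eq)

lemma add_nat: "F (t + real n) = F t + real n"
  proof (induction n)
  case (Suc n)
  then show ?case using add_one[of "t + real n"] by (simp add: algebra_simps)
qed simp

lemma diff_one: "F (t - 1) = F t - 1"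
  using add_one[of "t - 1"] by simp

lemma add_int: "F (t + of_int k) = F t + of_int k"
proof (cases "k \<ge> 0")
  case True
  then show ?thesis using add_nat[of t "nat k"] by simp
next
  case False
  then show ?thesis using add_nat[of "t + of_int k" "nat (- k)"] by simp
qed

lemma surjective: "\<exists>s. F s = t"
proof -
  define n where "n = nat \<lceil>\<bar>t - F 0\<bar>\<rceil>"
  have n: "\<bar>t - F 0\<bar> \<le> real n" unfolding n_def by linarith
  have "F (- real n) \<le> t" "t \<le> F (real n)"
    using n add_nat[of "- real n" n] add_nat[of 0 n] by auto
  then show ?thesis
    using IVT'[of F "- real n" t "real n"] continuous_on_subset[OF continuous] by auto
qed

lemma ret_continuous: "continuous_on UNIV ret"
  unfolding ret_def
  by (intro continuous_intros continuous_on_compose2[OF continuous continuous_on_compose2[OF continuous continuous]]) auto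

lemma ret_mono: "mono ret"
  by (auto simp: mono_def ret_def)

lemma ret_F: "ret (F t) = F (ret t)"
  by (simp add: ret_def diff_one)

lemma ret_add_int: "ret (t + of_int k) = ret t + of_int k"
  by (simp add: ret_def add_int)

lemma funpow_ret: "(ret ^^ n) t = (F ^^ (3 * n)) t - real n"
proof (induction n)
  case (Suc n)
  have "(ret ^^ Suc n) t = ret ((F ^^ (3 * n)) t + of_int (- int n))"
    using Suc by simp
  also have "\<dots> = (F ^^ (3 * Suc n)) t - real (Suc n)"
    unfolding ret_add_int by (simp add: ret_def eval_nat_numeral)
  finally show ?case .
qed simp

lemma funpow_ret_F: "(ret ^^ n) (F t) = F ((ret ^^ n) t)"
  by (induction n) (auto simp: ret_F)

text \<open>\<open>F\<close> is increasing and commutes with \<open>ret\<close>, so the sign of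
  \<open>ret t - t\<close> is carried from \<open>[a, F a]\<close> to its next two images. Together
  the three intervals cover the period from \<open>a\<close> to \<open>a + 1\<close>.\<close>

lemma ret_le_of_fundamental:
  assumes a: "ret a = a" and fund: "\<And>t. a \<le> t \<Longrightarrow> t \<le> F a \<Longrightarrow> ret t \<le> t"
  shows "ret t \<le> t"
proof -
  have step: "ret t \<le> t" if "F x \<le> t" "t \<le> F y" "\<And>s. x \<le> s \<Longrightarrow> s \<le> y \<Longrightarrow> ret s \<le> s" for x y t
  proof -
    obtain s where s: "F s = t" using surjective by blast
    with that have "ret s \<le> s" by auto
    then show ?thesis using s by (auto simp: ret_F)
  qed
  have 2: "ret t \<le> t" if "F a \<le> t" "t \<le> F (F a)" for t
    using step[OF that] fund by blast
  have 3: "ret t \<le> t" if "F (F a) \<le> t" "t \<le> F (F (F a))" for t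
    using step[OF that] 2 by blast
  have a3: "F (F (F a)) = a + 1" using a by (simp add: ret_def)
  define k where "k = \<lfloor>t - a\<rfloor>"
  let ?s = "t + of_int (- k)"
  have "a \<le> ?s" "?s \<le> F (F (F a))" unfolding a3 k_def by linarith+
  then have "ret ?s \<le> ?s" using fund[of ?s] 2[of ?s] 3[of ?s] by linarith
  then show ?thesis unfolding ret_add_int by simp
qed

lemma basin_image:
  assumes "\<forall>v\<in>F -` A. (\<lambda>n. (ret ^^ n) v) \<longlonglongrightarrow> y" and "v \<in> A"
  shows "(\<lambda>n. (ret ^^ n) v) \<longlonglongrightarrow> F y"
proof -
  obtain s where s: "F s = v" using surjective by blast
  with assms have "(\<lambda>n. (ret ^^ n) s) \<longlonglongrightarrow> y" by auto
  then have "(\<lambda>n. F ((ret ^^ n) s)) \<longlonglongrightarrow> F y"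
    using continuous
    by (intro isCont_tendsto_compose[of y F]) (auto simp: continuous_on_eq_continuous_at)
  then show ?thesis using s by (auto simp: funpow_ret_F)
qed

lemma ret_fixed_exists:
  assumes "ret t0 > t0" "ret t1 \<le> t1"
  shows "\<exists>a. ret a = a"
proof -
  have "ret t1 \<le> t1 \<and> t0 \<le> ret t0 \<or> t1 \<le> ret t1 \<and> ret t0 \<le> t0" using assms by simp
  from fixpoint_between[OF ret_continuous this] show ?thesis by blast
qed

text \<open>The sign of \<open>ret t - t\<close> is constant between \<open>a\<close> and
  \<open>F a\<close>. A negative sign would spread to the whole line and contradict
  \<open>t0\<close>, so orbits rise to \<open>F a\<close>.\<close>

lemma semistable_orbit:
  assumes a: "ret a = a" and unique: "\<forall>c\<in>{a<..<F a}. ret c \<noteq> c"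
    and t0: "ret t0 > t0" and v: "a < v" "v \<le> F a"
  shows "(\<lambda>n. (ret ^^ n) v) \<longlonglongrightarrow> F a"
proof -
  have Fa: "ret (F a) = F a" using a by (simp add: ret_F)
  have "ret c > c" if c: "a < c" "c < F a" for c
  proof (rule ccontr)
    assume "\<not> ret c > c"
    moreover have "ret c \<noteq> c" using bspec[OF unique, of c] c by simp
    ultimately have "ret c < c" by linarith
    then have *: "ret d < d" if "a < d" "d < F a" for d
      using no_fixpoint_same_sign[OF ret_continuous unique c that] by simp
    have "ret d \<le> d" if d: "a \<le> d" "d \<le> F a" for d
    proof -
      consider "d = a" | "d = F a" | "a < d" "d < F a" using d by linarith
      then show ?thesis using a Fa *[of d] by cases (simp_all add: less_imp_le)
    qed
    then have "ret t0 \<le> t0" by (rule ret_le_of_fundamental[OF a])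
    then show False using t0 by simp
  qed
  then have "\<forall>c\<in>{a<..<F a}. ret c > c" by simp
  from iterates_tendsto_right_fixpoint[OF ret_continuous ret_mono Fa this v] show ?thesis .
qed

text \<open>Take the fixed points \<open>a\<close> and \<open>b\<close> adjacent to a point where
  \<open>ret\<close> is below the identity. The displacement is negative between \<open>a\<close>
  and \<open>b\<close> and, because of \<open>t0\<close> and \<open>two\<close>, positive between
  \<open>b\<close> and \<open>F a\<close>; so the orbit of \<open>a\<close> attracts from both
  sides.\<close>

lemma attracting_repelling_orbits:
  assumes t0: "ret t0 > t0" and t1: "ret t1 < t1"
    and two: "\<And>a b c. ret a = a \<Longrightarrow> ret b = b \<Longrightarrow> ret c = c \<Longrightarrow> a < b \<Longrightarrow> b < c \<Longrightarrow> c < F a \<Longrightarrow> False"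
  shows "\<exists>a b. ret a = a \<and> ret b = b \<and> a < b \<and> b < F a \<and>
    (\<forall>v. b < v \<and> v < F b \<longrightarrow> (\<lambda>n. (ret ^^ n) v) \<longlonglongrightarrow> F a)"
proof -
  \<comment> \<open>An integer translate of \<open>t1\<close> lies between \<open>t0\<close> and
    \<open>t0 + 1\<close>, where \<open>ret\<close> is above the identity.\<close>
  define k where "k = \<lfloor>t1 - t0\<rfloor>"
  define s where "s = t1 + of_int (- k)"
  have s: "ret s < s" using t1 unfolding s_def ret_add_int by simp
  have t01: "ret (t0 + 1) > t0 + 1" using t0 ret_add_int[of t0 1] by simp
  have "s \<noteq> t0" using s t0 by auto
  then have st: "t0 < s" "s < t0 + 1" unfolding s_def k_def by linarith+
  have closed_fix: "closed {t. ret t = t}"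
    by (intro closed_Collect_eq continuous_intros ret_continuous)
  let ?A = "{t0..s} \<inter> {t. ret t = t}" and ?B = "{s..t0 + 1} \<inter> {t. ret t = t}"
  have compact: "compact ?A" "compact ?B" using closed_fix by auto
  have "\<exists>z. t0 \<le> z \<and> z \<le> s \<and> ret z = z" "\<exists>z. s \<le> z \<and> z \<le> t0 + 1 \<and> ret z = z"
    using fixpoint_between[OF ret_continuous, of t0 s]
      fixpoint_between[OF ret_continuous, of s "t0 + 1"] s t0 t01 st by (simp_all add: min_def max_def)
  then have nonempty: "?A \<noteq> {}" "?B \<noteq> {}" by auto
  \<comment> \<open>\<open>a\<close> is the last fixed point before \<open>s\<close>, and
    \<open>b\<close> below is the first one after it.\<close>
  obtain a where a: "a \<in> ?A" "\<forall>t\<in>?A. t \<le> a"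
    using compact_attains_sup[OF compact(1) nonempty(1)] by (elim bexE)
  obtain b where b: "b \<in> ?B" "\<forall>t\<in>?B. b \<le> t"
    using compact_attains_inf[OF compact(2) nonempty(2)] by (elim bexE)
  have fa: "ret a = a" and fb: "ret b = b" using a(1) b(1) by auto
  then have fFa: "ret (F a) = F a" by (simp add: ret_F)
  have "a \<noteq> s" "s \<noteq> b" using fa fb s by auto
  then have "a < s" "s < b" using a(1) b(1) by auto
  have nofix: "\<forall>c\<in>{a<..<b}. ret c \<noteq> c"
  proof (intro ballI notI)
    fix c assume c: "c \<in> {a<..<b}" and "ret c = c"
    then have "c \<in> ?A \<or> c \<in> ?B" using a(1) b(1) by (simp, linarith)
    moreover have "c \<notin> ?A" using bspec[OF a(2), of c] c by auto
    moreover have "c \<notin> ?B" using bspec[OF b(2), of c] c by auto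
    ultimately show False by blast
  qed
  have down: "ret c < c" if "a < c" "c < b" for c
    using no_fixpoint_same_sign[OF ret_continuous nofix \<open>a < s\<close> \<open>s < b\<close> that] s by simp
  have "b \<le> F a" using bspec[OF nofix, of "F a"] greater[of a] fFa by fastforce
  moreover have "b \<noteq> F a"
  proof
    assume "b = F a"
    have "ret d \<le> d" if d: "a \<le> d" "d \<le> F a" for d
    proof -
      consider "d = a" | "d = F a" | "a < d" "d < b" using d \<open>b = F a\<close> by linarith
      then show ?thesis using fa fFa down[of d] by cases (simp_all add: less_imp_le)
    qed
    then have "ret t0 \<le> t0" by (rule ret_le_of_fundamental[OF fa])
    then show False using t0 by simp
  qed
  ultimately have "b < F a" by simp
  have nofix': "\<forall>c\<in>{b<..<F a}. ret c \<noteq> c"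
    using two[OF fa fb] \<open>a < s\<close> \<open>s < b\<close> by auto
  have up: "ret c > c" if c: "b < c" "c < F a" for c
  proof (rule ccontr)
    assume "\<not> ret c > c"
    moreover have "ret c \<noteq> c" using bspec[OF nofix', of c] c by simp
    ultimately have "ret c < c" by linarith
    then have *: "ret d < d" if "b < d" "d < F a" for d
      using no_fixpoint_same_sign[OF ret_continuous nofix' c that] by simp
    have "ret d \<le> d" if d: "a \<le> d" "d \<le> F a" for d
    proof -
      consider "d = a" | "d = F a" | "d = b" | "a < d" "d < b" | "b < d" "d < F a"
        using d by linarith
      then show ?thesis using fa fb fFa down[of d] *[of d] by cases (simp_all add: less_imp_le)
    qed
    then have "ret t0 \<le> t0" by (rule ret_le_of_fundamental[OF fa])
    then show False using t0 by simp
  qed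
  have "(\<lambda>n. (ret ^^ n) v) \<longlonglongrightarrow> F a" if v: "b < v" "v < F b" for v
  proof (cases "v \<le> F a")
    case True
    have "\<forall>c\<in>{b<..<F a}. ret c > c" using up by simp
    from iterates_tendsto_right_fixpoint[OF ret_continuous ret_mono fFa this v(1) True]
    show ?thesis .
  next
    case False
    have *: "\<forall>c\<in>{a<..<b}. ret c < c" using down by simp
    \<comment> \<open>The interval from \<open>F a\<close> to \<open>F b\<close> is the image of the
      one from \<open>a\<close> to \<open>b\<close>, where orbits fall to \<open>a\<close>.\<close>
    have "\<forall>w\<in>F -` {F a..<F b}. (\<lambda>n. (ret ^^ n) w) \<longlonglongrightarrow> a"
      using iterates_tendsto_left_fixpoint[OF ret_continuous ret_mono fa *] by simp
    from basin_image[OF this, of v] show ?thesis using False v by auto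
  qed
  then show ?thesis using fa fb \<open>a < s\<close> \<open>s < b\<close> \<open>b < F a\<close> by (intro exI[of _ a] exI[of _ b]) auto
qed

end

section \<open>Hyperbolic distances\<close>

lemma cross2_eq: "cross2 a b = Re a * Im b - Im a * Re b"
  by (simp add: cross2_def)

lemma collinear_iff_cross2: "collinear {P, Q, S} \<longleftrightarrow> cross2 (Q - P) (S - P) = 0"
proof -
  have "collinear {P, Q, S} \<longleftrightarrow> collinear {Q, P, S}" by (simp add: insert_commute)
  also have "\<dots> \<longleftrightarrow> collinear {0, Q - P, S - P}" by (rule collinear_3) simp
  also have "\<dots> \<longleftrightarrow> Im ((S - P) / (Q - P)) = 0"
    by (simp add: collinear_iff_Reals complex_is_Real_iff)
  also have "\<dots> \<longleftrightarrow> cross2 (Q - P) (S - P) = 0"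
    by (cases "Q = P") (auto simp: Im_divide cross2_eq sum_power2_eq_zero_iff complex_eq_iff algebra_simps)
  finally show ?thesis .
qed

lemma mem_diskD_iff: "P \<in> diskD \<longleftrightarrow> P \<bullet> P < 1"
  by (simp add: diskD_def dot_square_norm abs_square_less_1)

lemma mem_circleS_iff: "u \<in> circleS \<longleftrightarrow> u \<bullet> u = 1"
  by (simp add: circleS_def norm_eq_1)

text \<open>The Minkowski product of the lifts \<open>(1, P)\<close> and \<open>(1, Q)\<close>.\<close>

definition mink :: "complex \<Rightarrow> complex \<Rightarrow> real" where
  "mink P Q = 1 - P \<bullet> Q"

lemma mink_self_pos: "P \<in> diskD \<Longrightarrow> mink P P > 0"
  by (simp add: mink_def mem_diskD_iff)

text \<open>The lifts of the chord endpoints are isotropic, so only the mixed terms survive; the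
  product of the two endpoints is half the squared chord length.\<close>

lemma chord_point_mink:
  assumes "v1 \<in> circleS" "v2 \<in> circleS"
    and "P = v1 + p *\<^sub>R (v2 - v1)" "Q = v1 + q *\<^sub>R (v2 - v1)"
  shows "mink P Q = ((1 - p) * q + p * (1 - q)) * (dist v1 v2)\<^sup>2 / 2"
proof -
  have d: "(dist v1 v2)\<^sup>2 = 2 - 2 * (v1 \<bullet> v2)"
    using assms(1,2) by (simp add: dist_norm power2_norm_eq_inner inner_diff_left inner_diff_right
        inner_commute mem_circleS_iff)
  show ?thesis unfolding d using assms(1,2)
    by (simp add: mink_def assms(3,4) mem_circleS_iff inner_add_left inner_add_right inner_diff_left
        inner_diff_right inner_commute) (simp add: algebra_simps)
qed

lemma cosh_half_ln_ratio:
  fixes x y :: real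
  assumes "x > 0" "y > 0"
  shows "cosh ((1/2) * \<bar>ln (x / y)\<bar>) = (x + y) / (2 * sqrt (x * y))"
proof -
  have "cosh ((1/2) * \<bar>ln (x / y)\<bar>) = cosh \<bar>(1/2) * ln (x / y)\<bar>" by (simp add: abs_mult)
  also have "\<dots> = cosh ((1/2) * ln (x / y))" by (rule cosh_real_abs)
  also have "(1/2) * ln (x / y) = ln (sqrt (x / y))" using assms by (simp add: ln_sqrt)
  also have "cosh \<dots> = (sqrt (x / y) + inverse (sqrt (x / y))) / 2"
    using assms by (intro cosh_ln_real) auto
  also have "\<dots> = (x + y) / (2 * sqrt (x * y))"
    using assms by (simp add: real_sqrt_divide real_sqrt_mult field_simps)
  finally show ?thesis .
qed

text \<open>In affine coordinates \<open>p\<close>, \<open>q\<close> along the chord, the cross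
  ratio is the quotient of \<open>q * (1 - p)\<close> and \<open>p * (1 - q)\<close>;
  \<open>cosh\<close> of half its logarithm is their arithmetic mean over their geometric mean. The
  result does not involve \<open>v1\<close> and \<open>v2\<close>.\<close>

lemma cosh_cross_ratio:
  assumes PQ: "P \<in> diskD" "Q \<in> diskD" and v: "v1 \<in> circleS" "v2 \<in> circleS" "v1 \<noteq> v2"
    and col: "collinear {P, Q, v1}" "collinear {P, Q, v2}"
  shows "cosh ((1/2) * \<bar>ln ((dist v1 Q * dist v2 P) / (dist v1 P * dist v2 Q))\<bar>)
    = mink P Q / sqrt (mink P P * mink Q Q)"
proof (cases "P = Q")
  case True
  \<comment> \<open>For \<open>P = Q\<close> the chord is arbitrary, but the cross ratio and the
    right side are both 1.\<close>
  then have "v1 \<noteq> P" "v2 \<noteq> P" using PQ v by (auto simp: mem_diskD_iff mem_circleS_iff)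
  then show ?thesis using True mink_self_pos[OF PQ(2)] by simp
next
  case False
  have "collinear {P, v1, Q}" "collinear {P, v2, Q}" using col by (simp_all add: insert_commute)
  then obtain s t where st: "v1 = s *\<^sub>R P + (1 - s) *\<^sub>R Q" "v2 = t *\<^sub>R P + (1 - t) *\<^sub>R Q"
    using False unfolding collinear_3_expand by blast
  have "s \<noteq> t" using st v by auto
  \<comment> \<open>On their line, \<open>P\<close> and \<open>Q\<close> have parameters 1 and 0,
    and \<open>v1\<close>, \<open>v2\<close> have \<open>s\<close>, \<open>t\<close>; rescaling to
    the chord gives \<open>p\<close> and \<open>q\<close>.\<close>
  define p where "p = (1 - s) / (t - s)"
  define q where "q = - s / (t - s)"
  have diff: "v2 - v1 = (t - s) *\<^sub>R (P - Q)" unfolding st by (simp add: algebra_simps)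
  have P: "P = v1 + p *\<^sub>R (v2 - v1)" unfolding diff using \<open>s \<noteq> t\<close>
    by (simp add: p_def st) (simp add: algebra_simps)
  have Q: "Q = v1 + q *\<^sub>R (v2 - v1)" unfolding diff using \<open>s \<noteq> t\<close>
    by (simp add: q_def st) (simp add: algebra_simps)
  let ?L = "dist v1 v2"
  have L: "?L > 0" using v by simp
  have mP: "mink P P = p * (1 - p) * ?L\<^sup>2" and mQ: "mink Q Q = q * (1 - q) * ?L\<^sup>2"
    and mPQ: "mink P Q = ((1 - p) * q + p * (1 - q)) * ?L\<^sup>2 / 2"
    using chord_point_mink[OF v(1,2) P P] chord_point_mink[OF v(1,2) Q Q]
      chord_point_mink[OF v(1,2) P Q] by (simp_all add: mult.commute)
  have "p * (1 - p) > 0" "q * (1 - q) > 0"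
    using mink_self_pos[OF PQ(1)] mink_self_pos[OF PQ(2)] L unfolding mP mQ
    by (simp_all add: zero_less_mult_iff)
  then have p: "0 < p" "p < 1" and q: "0 < q" "q < 1" by (auto simp: zero_less_mult_iff)
  have d1: "dist v1 X = x * ?L" "dist v2 X = (1 - x) * ?L"
    if "X = v1 + x *\<^sub>R (v2 - v1)" "0 < x" "x < 1" for X x
  proof -
    have "v1 - X = - (x *\<^sub>R (v2 - v1))" "v2 - X = (1 - x) *\<^sub>R (v2 - v1)"
      unfolding that(1) by (simp_all add: algebra_simps)
    then show "dist v1 X = x * ?L" "dist v2 X = (1 - x) * ?L"
      using that(2,3) by (simp_all add: dist_norm norm_minus_commute)
  qed
  have "(dist v1 Q * dist v2 P) / (dist v1 P * dist v2 Q) = (q * (1 - p)) / (p * (1 - q))"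
    using L d1[OF P p] d1[OF Q q] by simp
  moreover have "mink P Q / sqrt (mink P P * mink Q Q)
      = (q * (1 - p) + p * (1 - q)) / (2 * sqrt (q * (1 - p) * (p * (1 - q))))"
  proof -
    have "mink P P * mink Q Q = (q * (1 - p) * (p * (1 - q))) * (?L\<^sup>2 * ?L\<^sup>2)"
      unfolding mP mQ by (simp add: mult_ac)
    then have "sqrt (mink P P * mink Q Q) = sqrt (q * (1 - p) * (p * (1 - q))) * ?L\<^sup>2"
      by (simp only: real_sqrt_mult real_sqrt_mult_self abs_power2)
    then show ?thesis unfolding mPQ using L by (simp add: mult_ac)
  qed
  ultimately show ?thesis using p q cosh_half_ln_ratio[of "q * (1 - p)" "p * (1 - q)"] by simp
qed

lemma chord_endpoints_exist:
  assumes "P \<in> diskD"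
  shows "\<exists>v1 v2. v1 \<in> circleS \<and> v2 \<in> circleS \<and> v1 \<noteq> v2 \<and> collinear {P, Q, v1} \<and> collinear {P, Q, v2}"
proof -
  define e where "e = (if Q = P then 1 else sgn (Q - P))"
  have e: "e \<bullet> e = 1" by (simp add: e_def dot_square_norm norm_sgn)
  have col: "collinear {P, Q, P + s *\<^sub>R e}" for s
    unfolding collinear_iff_cross2 by (simp add: e_def cross2_eq sgn_div_norm)
  \<comment> \<open>Completing the square turns the equation of the circle at
    \<open>P + s *\<^sub>R e\<close> into \<open>(s + c)\<^sup>2 = r\<^sup>2\<close>.\<close>
  define c where "c = P \<bullet> e"
  define r where "r = sqrt (c\<^sup>2 + (1 - P \<bullet> P))"
  have "1 - P \<bullet> P > 0" using assms by (simp add: mem_diskD_iff)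
  then have r: "r > 0" "r\<^sup>2 = c\<^sup>2 + (1 - P \<bullet> P)"
    unfolding r_def by (auto simp: add_nonneg_pos)
  have circ: "P + s *\<^sub>R e \<in> circleS" if "(s + c)\<^sup>2 = r\<^sup>2" for s
  proof -
    have "(P + s *\<^sub>R e) \<bullet> (P + s *\<^sub>R e) = P \<bullet> P + 2 * s * c + s\<^sup>2"
      using e by (simp add: c_def inner_add_left inner_add_right inner_commute power2_eq_square)
    then show ?thesis using that r(2) by (simp add: mem_circleS_iff power2_eq_square algebra_simps)
  qed
  have "P + (r - c) *\<^sub>R e \<noteq> P + (- r - c) *\<^sub>R e" using r(1) e by auto
  moreover have "P + (r - c) *\<^sub>R e \<in> circleS" "P + (- r - c) *\<^sub>R e \<in> circleS"
    by (auto intro!: circ)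
  ultimately show ?thesis using col by blast
qed

lemma cosh_dprime:
  assumes PQ: "P \<in> diskD" "Q \<in> diskD"
  shows "cosh (dprime P Q) = mink P Q / sqrt (mink P P * mink Q Q)" and "dprime P Q \<ge> 0"
proof -
  obtain v1 v2 where v: "v1 \<in> circleS" "v2 \<in> circleS" "v1 \<noteq> v2"
      "collinear {P, Q, v1}" "collinear {P, Q, v2}"
    using chord_endpoints_exist[OF PQ(1)] by blast
  define d where "d = (1/2) * \<bar>ln ((dist v1 Q * dist v2 P) / (dist v1 P * dist v2 Q))\<bar>"
  have d: "cosh d = mink P Q / sqrt (mink P P * mink Q Q)" "d \<ge> 0"
    unfolding d_def using cosh_cross_ratio[OF PQ v] by auto
  have "dprime P Q = d" unfolding dprime_def
  proof (rule the_equality)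
    show "\<exists>v1 v2. v1 \<in> circleS \<and> v2 \<in> circleS \<and> v1 \<noteq> v2 \<and> collinear {P, Q, v1} \<and>
      collinear {P, Q, v2} \<and> d = (1/2) * \<bar>ln ((dist v1 Q * dist v2 P) / (dist v1 P * dist v2 Q))\<bar>"
      using v d_def by blast
    fix d' assume "\<exists>v1 v2. v1 \<in> circleS \<and> v2 \<in> circleS \<and> v1 \<noteq> v2 \<and> collinear {P, Q, v1} \<and>
      collinear {P, Q, v2} \<and> d' = (1/2) * \<bar>ln ((dist v1 Q * dist v2 P) / (dist v1 P * dist v2 Q))\<bar>"
    then obtain w1 w2 where w: "w1 \<in> circleS" "w2 \<in> circleS" "w1 \<noteq> w2"
        "collinear {P, Q, w1}" "collinear {P, Q, w2}"
        and d': "d' = (1/2) * \<bar>ln ((dist w1 Q * dist w2 P) / (dist w1 P * dist w2 Q))\<bar>"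
      by blast
    have "cosh d' = cosh d" "d' \<ge> 0"
      using cosh_cross_ratio[OF PQ w] d(1) unfolding d' by (simp, simp)
    \<comment> \<open>\<open>cosh\<close> is injective on nonnegative reals, so all admissible
      endpoints give one value.\<close>
    then show "d' = d"
      using d(2) by (metis cosh_real_nonneg_le_iff order.antisym order.refl)
  qed
  then show "cosh (dprime P Q) = mink P Q / sqrt (mink P P * mink Q Q)" "dprime P Q \<ge> 0"
    using d by auto
qed

section \<open>Gram determinants and the distance to a line\<close>

lemma cosh_dprime_square:
  assumes "P \<in> diskD" "Q \<in> diskD"
  shows "(cosh (dprime P Q))\<^sup>2 = (mink P Q)\<^sup>2 / (mink P P * mink Q Q)"
  using mink_self_pos[OF assms(1)] mink_self_pos[OF assms(2)]
  by (simp add: cosh_dprime[OF assms] power_divide)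

text \<open>Minus the Gram determinant of the lifts; it is positive for distinct points of the disk
  because their span has signature (1,1).\<close>

definition mink_gram :: "complex \<Rightarrow> complex \<Rightarrow> real" where
  "mink_gram P Q = (mink P Q)\<^sup>2 - mink P P * mink Q Q"

lemma mink_gram_eq: "mink_gram P Q = (norm (Q - P))\<^sup>2 - (cross2 P Q)\<^sup>2"
  unfolding mink_gram_def mink_def inner_complex_def cmod_power2 cross2_eq minus_complex.sel by algebra

lemma mink_gram_pos:
  assumes "P \<in> diskD" "P \<noteq> Q"
  shows "mink_gram P Q > 0"
proof -
  have "mink_gram P Q = (norm (Q - P))\<^sup>2 * mink P P + (P \<bullet> (Q - P))\<^sup>2"
    unfolding mink_gram_def mink_def inner_complex_def cmod_power2 cross2_eq minus_complex.sel by algebra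
  then show ?thesis using mink_self_pos[OF assms(1)] assms(2) by (simp add: add_pos_nonneg)
qed

lemma sinh_dprime_square:
  assumes "P \<in> diskD" "Q \<in> diskD"
  shows "(sinh (dprime P Q))\<^sup>2 = mink_gram P Q / (mink P P * mink Q Q)"
  using mink_self_pos[OF assms(1)] mink_self_pos[OF assms(2)] cosh_dprime_square[OF assms]
  by (simp add: sinh_square_eq mink_gram_def diff_divide_distrib)

text \<open>The minimum is attained at the Minkowski-orthogonal projection of \<open>(1, R)\<close> to the span of
  \<open>(1, P)\<close> and \<open>(1, Q)\<close>.\<close>

lemma foot_exists:
  assumes PQR: "P \<in> diskD" "Q \<in> diskD" "R \<in> diskD" and "P \<noteq> Q"
  defines "D \<equiv> cross2 (Q - P) (R - P)"
  shows "\<exists>S\<in>diskD. collinear {P, Q, S} \<and>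
    (sinh (dprime R S))\<^sup>2 = D\<^sup>2 / (mink_gram P Q * mink R R)"
proof -
  \<comment> \<open>The vector \<open>n = (cross2 P Q, - \<i> * (Q - P))\<close> is normal to the
    span, with self-product \<open>- N\<close> and product \<open>D\<close> with
    \<open>(1, R)\<close>. Hence \<open>(m, Z) = N (1, R) + D n\<close> is \<open>N\<close> times
    the projection of \<open>(1, R)\<close>.\<close>
  define N where "N = mink_gram P Q"
  define m where "m = N + D * cross2 P Q"
  define Z where "Z = of_real N * R - \<i> * of_real D * (Q - P)"
  have N: "N > 0" unfolding N_def by (rule mink_gram_pos[OF PQR(1) \<open>P \<noteq> Q\<close>])
  have RR: "mink R R > 0" by (rule mink_self_pos[OF PQR(3)])
  have Neq: "N = (Re Q - Re P)\<^sup>2 + (Im Q - Im P)\<^sup>2 - (Re P * Im Q - Im P * Re Q)\<^sup>2"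
    unfolding N_def mink_gram_eq by (simp add: cmod_power2 cross2_eq)
  have Zc: "Re Z = N * Re R + D * (Im Q - Im P)" "Im Z = N * Im R - D * (Re Q - Re P)"
    by (simp_all add: Z_def)
  have D: "D = (Re Q - Re P) * (Im R - Im P) - (Im Q - Im P) * (Re R - Re P)"
    by (simp add: D_def cross2_eq)
  have 1: "m\<^sup>2 - ((Re Z)\<^sup>2 + (Im Z)\<^sup>2) = N * (N * mink R R + D\<^sup>2)"
    unfolding m_def Zc mink_def inner_complex_def cross2_eq inner_real_def
    using Neq D by algebra
  have 2: "m - (Re R * Re Z + Im R * Im Z) = N * mink R R + D\<^sup>2"
    unfolding m_def Zc mink_def inner_complex_def cross2_eq inner_real_def
    using Neq D by algebra
  have 3: "(Re Q - Re P) * (Im Z - m * Im P) - (Im Q - Im P) * (Re Z - m * Re P) = 0"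
    unfolding m_def Zc cross2_eq using Neq D by algebra
  have pos: "N * mink R R + D\<^sup>2 > 0" using N RR by (simp add: add_pos_nonneg)
  then have "N * (N * mink R R + D\<^sup>2) > 0" using N by simp
  \<comment> \<open>The projection is timelike, so its first coordinate is nonzero and division by
    it returns to the disk.\<close>
  then have "m \<noteq> 0" using 1 by (auto simp: not_less) (smt (verit) sum_power2_ge_zero)
  define S where "S = Z / of_real m"
  have Sc: "Re S = Re Z / m" "Im S = Im Z / m" by (simp_all add: S_def)
  have SS: "mink S S = N * (N * mink R R + D\<^sup>2) / m\<^sup>2"
    using \<open>m \<noteq> 0\<close> unfolding 1[symmetric] mink_def[of S S] inner_complex_def Sc
    by (simp add: field_simps power2_eq_square)
  have RS: "mink R S = (N * mink R R + D\<^sup>2) / m"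
    using \<open>m \<noteq> 0\<close> unfolding 2[symmetric] mink_def[of R S] inner_complex_def Sc
    by (simp add: field_simps power2_eq_square)
  have "mink S S > 0" unfolding SS using \<open>m \<noteq> 0\<close> N pos by simp
  then have S: "S \<in> diskD" by (simp add: mink_def mem_diskD_iff)
  have "m * cross2 (Q - P) (S - P) = 0"
    unfolding 3[symmetric] cross2_eq minus_complex.sel Sc
    using \<open>m \<noteq> 0\<close> by (simp add: field_simps)
  then have "collinear {P, Q, S}" using \<open>m \<noteq> 0\<close> by (simp add: collinear_iff_cross2)
  moreover have "(sinh (dprime R S))\<^sup>2 = D\<^sup>2 / (N * mink R R)"
  proof -
    have "mink_gram R S / (mink R R * mink S S) = (mink R S)\<^sup>2 / (mink R R * mink S S) - 1"
      using RR \<open>mink S S > 0\<close> by (simp add: mink_gram_def diff_divide_distrib)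
    also have "(mink R S)\<^sup>2 / (mink R R * mink S S) = (N * mink R R + D\<^sup>2) / (mink R R * N)"
      unfolding RS SS using \<open>m \<noteq> 0\<close> N RR pos by (simp add: power2_eq_square)
    also have "\<dots> - 1 = D\<^sup>2 / (N * mink R R)" using N RR by (simp add: field_simps)
    finally show ?thesis using sinh_dprime_square[OF PQR(3) S] by simp
  qed
  ultimately show ?thesis using S by (auto simp: N_def)
qed

lemma sinh_dprime_line_ge:
  assumes PQR: "P \<in> diskD" "Q \<in> diskD" "R \<in> diskD" and "P \<noteq> Q"
    and S: "S \<in> diskD" "collinear {P, Q, S}"
  defines "D \<equiv> cross2 (Q - P) (R - P)"
  shows "D\<^sup>2 / (mink_gram P Q * mink R R) \<le> (sinh (dprime R S))\<^sup>2"
proof -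
  define N where "N = mink_gram P Q"
  have N: "N > 0" unfolding N_def by (rule mink_gram_pos[OF PQR(1) \<open>P \<noteq> Q\<close>])
  have RR: "mink R R > 0" "mink S S > 0" using mink_self_pos PQR S by blast+
  have Neq: "N = (Re Q - Re P)\<^sup>2 + (Im Q - Im P)\<^sup>2 - (Re P * Im Q - Im P * Re Q)\<^sup>2"
    unfolding N_def mink_gram_eq by (simp add: cmod_power2 cross2_eq)
  have col: "(Re Q - Re P) * (Im S - Im P) - (Im Q - Im P) * (Re S - Re P) = 0"
    using S(2) unfolding collinear_iff_cross2 cross2_eq by simp
  have D: "D = (Re Q - Re P) * (Im R - Im P) - (Im Q - Im P) * (Re R - Re P)"
    by (simp add: D_def cross2_eq)
  define \<kappa> where "\<kappa> = Re P * Im Q - Im P * Re Q"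
  \<comment> \<open>\<open>T\<close> is the determinant with rows \<open>(1, R)\<close>,
    \<open>(1, S)\<close> and the normal vector \<open>(\<kappa>, - \<i> * (Q - P))\<close>. Its
    square is their Gram determinant, which reduces to the left side below since \<open>S\<close> is
    on the line.\<close>
  define T where "T = (Re S * - (Re Q - Re P) - Im S * (Im Q - Im P))
    - (Re R * - (Re Q - Re P) - Im R * (Im Q - Im P)) + \<kappa> * (Re R * Im S - Im R * Re S)"
  have "N * mink_gram R S - D\<^sup>2 * mink S S = T\<^sup>2"
    unfolding mink_gram_def mink_def inner_complex_def inner_real_def
    using Neq D col T_def \<kappa>_def by algebra
  then have "D\<^sup>2 * mink S S \<le> N * mink_gram R S" by (smt (verit) zero_le_power2)
  then have "D\<^sup>2 / (N * mink R R) \<le> mink_gram R S / (mink R R * mink S S)"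
    using N RR by (simp add: field_simps)
  then show ?thesis using sinh_dprime_square[OF PQR(3) S(1)] by (simp add: N_def)
qed

lemma sinh_delta:
  assumes PQR: "P \<in> diskD" "Q \<in> diskD" "R \<in> diskD" and "P \<noteq> Q"
  shows "(sinh (delta P Q R))\<^sup>2 = (cross2 (Q - P) (R - P))\<^sup>2 / (mink_gram P Q * mink R R)"
    and "delta P Q R \<ge> 0"
proof -
  obtain S where S: "S \<in> diskD" "collinear {P, Q, S}"
    "(sinh (dprime R S))\<^sup>2 = (cross2 (Q - P) (R - P))\<^sup>2 / (mink_gram P Q * mink R R)"
    using foot_exists[OF assms] by blast
  have nonneg: "dprime R S' \<ge> 0" if "S' \<in> diskD" for S' using cosh_dprime(2)[OF PQR(3) that] .
  have "delta P Q R = dprime R S" unfolding delta_def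
  proof (rule cInf_eq_minimum)
    show "dprime R S \<in> {dprime R S |S. S \<in> diskD \<and> collinear {P, Q, S}}" using S by blast
    fix x assume "x \<in> {dprime R S |S. S \<in> diskD \<and> collinear {P, Q, S}}"
    then obtain S' where S': "x = dprime R S'" "S' \<in> diskD" "collinear {P, Q, S'}" by blast
    have "(sinh (dprime R S))\<^sup>2 \<le> (sinh x)\<^sup>2"
      unfolding S(3) S'(1) by (rule sinh_dprime_line_ge[OF assms S'(2,3)])
    then have "sinh (dprime R S) \<le> sinh x"
      by (rule power2_le_imp_le) (use nonneg S' in simp)
    then show "dprime R S \<le> x" by simp
  qed
  then show "(sinh (delta P Q R))\<^sup>2 = (cross2 (Q - P) (R - P))\<^sup>2 / (mink_gram P Q * mink R R)"
    "delta P Q R \<ge> 0" using S nonneg by auto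
qed

section \<open>Comparison of \<open>delta\<close> with \<open>Deltaprime\<close>\<close>

lemma sinh_Deltaprime:
  assumes "dprime P Q > 0"
  shows "sinh (Deltaprime P Q) = 1 / sinh (dprime P Q)"
proof -
  define e where "e = exp (dprime P Q)"
  have e: "e > 1" using assms by (simp add: e_def)
  have "e * e > 1 * 1" using e by (intro mult_strict_mono) auto
  have "sinh (Deltaprime P Q) = ((e + 1) / (e - 1) - inverse ((e + 1) / (e - 1))) / 2"
    unfolding Deltaprime_def e_def[symmetric] using e by (intro sinh_ln_real) auto
  also have "\<dots> = 1 / ((e - 1 / e) / 2)" using e \<open>e * e > 1 * 1\<close> by (simp add: field_simps)
  also have "(e - 1 / e) / 2 = sinh (dprime P Q)"
    by (simp add: sinh_field_def e_def exp_minus field_simps)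
  finally show ?thesis .
qed

text \<open>In the product of the two squared hyperbolic sines \<open>mink_gram P Q\<close> cancels,
  leaving \<open>D\<^sup>2 / M\<close>; \<open>sinh_Deltaprime\<close> turns the comparison into one
  of this product with 1.\<close>

lemma delta_Deltaprime:
  assumes PQR: "P \<in> diskD" "Q \<in> diskD" "R \<in> diskD" and "P \<noteq> Q"
  defines "D \<equiv> cross2 (Q - P) (R - P)" and "M \<equiv> mink P P * mink Q Q * mink R R"
  shows "delta P Q R = Deltaprime P Q \<Longrightarrow> D\<^sup>2 = M"
    and "delta P Q R > Deltaprime P Q \<Longrightarrow> D\<^sup>2 > M"
proof -
  note pos = PQR[THEN mink_self_pos] mink_gram_pos[OF PQR(1) \<open>P \<noteq> Q\<close>]
  let ?d = "dprime P Q"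
  have "(sinh ?d)\<^sup>2 > 0" unfolding sinh_dprime_square[OF PQR(1,2)] using pos by simp
  then have d: "?d > 0" using cosh_dprime(2)[OF PQR(1,2)] by (cases "?d = 0") auto
  then have sd: "sinh ?d > 0" by simp
  have "(sinh (delta P Q R))\<^sup>2 * (sinh ?d)\<^sup>2 = D\<^sup>2 / M"
    unfolding sinh_delta(1)[OF PQR \<open>P \<noteq> Q\<close>] sinh_dprime_square[OF PQR(1,2)] D_def M_def
    using pos by (simp add: field_simps)
  then have key: "(sinh (delta P Q R) * sinh ?d)\<^sup>2 = D\<^sup>2 / M" by (simp add: power_mult_distrib)
  have M: "M > 0" using pos by (simp add: M_def)
  show "D\<^sup>2 = M" if "delta P Q R = Deltaprime P Q"
    using key sd M unfolding that sinh_Deltaprime[OF d] by simp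
  show "D\<^sup>2 > M" if "delta P Q R > Deltaprime P Q"
  proof -
    have "sinh (delta P Q R) > 1 / sinh ?d" using that by (simp flip: sinh_Deltaprime[OF d])
    then have "sinh (delta P Q R) * sinh ?d > 1" using sd by (simp add: field_simps)
    then have "(sinh (delta P Q R) * sinh ?d)\<^sup>2 > 1" by (simp add: one_less_power)
    then show ?thesis unfolding key using M by simp
  qed
qed

section \<open>Lifts of half-turns\<close>

lemma circ_mem [simp]: "circ t \<in> circleS"
  by (simp add: circ_def circleS_def)

lemma continuous_on_circ [continuous_intros]:
  "continuous_on A f \<Longrightarrow> continuous_on A (\<lambda>x. circ (f x))"
  unfolding circ_def by (intro continuous_intros)

lemma circ_eq_iff: "circ s = circ t \<longleftrightarrow> s - t \<in> \<int>"
proof -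
  have "circ s = circ t \<longleftrightarrow> sin (2 * pi * s) = sin (2 * pi * t) \<and> cos (2 * pi * s) = cos (2 * pi * t)"
    by (auto simp: circ_def complex_eq_iff)
  also have "\<dots> \<longleftrightarrow> (\<exists>n::int. 2 * pi * s = 2 * pi * t + 2 * pi * n)" by (rule sin_cos_eq_iff)
  also have "\<dots> \<longleftrightarrow> (\<exists>n::int. s - t = of_int n)"
  proof (intro ex_cong1)
    fix n :: int
    have "2 * pi * s = 2 * pi * t + 2 * pi * n \<longleftrightarrow> 2 * pi * s = 2 * pi * (t + n)"
      by (simp add: algebra_simps)
    also have "\<dots> \<longleftrightarrow> s - t = of_int n" by auto
    finally show "2 * pi * s = 2 * pi * t + 2 * pi * n \<longleftrightarrow> s - t = of_int n" .
  qed
  also have "\<dots> \<longleftrightarrow> s - t \<in> \<int>" by (auto simp: Ints_def)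
  finally show ?thesis .
qed

lemma circ_add_int [simp]: "circ (t + of_int k) = circ t"
  by (simp add: circ_eq_iff)

lemma circ_eq_imp_eq:
  assumes "circ s = circ t" "\<bar>s - t\<bar> < 1"
  shows "s = t"
proof -
  obtain k where "s - t = of_int k" using assms(1) by (auto simp: circ_eq_iff elim: Ints_cases)
  moreover from this have "k = 0" using assms(2) by linarith
  ultimately show ?thesis by simp
qed

lemma circ_surj:
  assumes "u \<in> circleS"
  shows "\<exists>s. x \<le> s \<and> s < x + 1 \<and> circ s = u"
proof -
  have "cis (Arg u) = u" using assms by (subst cis_Arg) (auto simp: circleS_def sgn_div_norm)
  then have u: "circ (Arg u / (2 * pi)) = u" by (simp add: circ_def)
  define y where "y = Arg u / (2 * pi)"
  let ?s = "y + of_int (- \<lfloor>y - x\<rfloor>)"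
  have "circ ?s = u" using u unfolding circ_add_int y_def .
  moreover have "x \<le> ?s" "?s < x + 1" by (simp, linarith)+
  ultimately show ?thesis by blast
qed

text \<open>\<open>Arg\<close>, measured in turns, differs from the parameter by an integer, which
  \<open>frac\<close> removes.\<close>

lemma ccw_dist_circ: "ccw_dist (circ s) (circ t) = frac (t - s)"
proof -
  have *: "Arg (circ t) / (2 * pi) - t \<in> \<int>" for t
  proof -
    have "circ (Arg (circ t) / (2 * pi)) = circ t"
      by (simp add: circ_def cis_Arg sgn_div_norm)
    then show ?thesis by (simp only: circ_eq_iff)
  qed
  have "(Arg (circ t) - Arg (circ s)) / (2 * pi)
    = (t - s) + ((Arg (circ t) / (2 * pi) - t) - (Arg (circ s) / (2 * pi) - s))"
    by (simp add: diff_divide_distrib)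
  then show ?thesis unfolding ccw_dist_def
    using frac_add_int_right[OF Ints_diff[OF *[of t] *[of s]], of "t - s"] by simp
qed

text \<open>Since \<open>y < x + 1\<close>, the interval does not wrap around and
  \<open>frac\<close> leaves its length unchanged.\<close>

lemma mem_ccw_arc_circ:
  assumes "x \<le> y" "y < x + 1"
  shows "v \<in> ccw_arc (circ x) (circ y) \<longleftrightarrow> (\<exists>s. x \<le> s \<and> s \<le> y \<and> v = circ s)"
proof
  assume "v \<in> ccw_arc (circ x) (circ y)"
  then have v: "v \<in> circleS" "ccw_dist (circ x) v \<le> ccw_dist (circ x) (circ y)"
    by (auto simp: ccw_arc_def)
  obtain s where s: "x \<le> s" "s < x + 1" "circ s = v" using circ_surj[OF v(1)] by blast
  have "s - x \<le> y - x" using v(2) s assms unfolding s(3)[symmetric] ccw_dist_circ by simp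
  then show "\<exists>s. x \<le> s \<and> s \<le> y \<and> v = circ s" using s by auto
next
  assume "\<exists>s. x \<le> s \<and> s \<le> y \<and> v = circ s"
  then show "v \<in> ccw_arc (circ x) (circ y)" using assms by (auto simp: ccw_arc_def ccw_dist_circ)
qed

lemma sgn_sin_pi:
  fixes x :: real
  assumes "\<bar>x\<bar> < 1"
  shows "sgn (sin (pi * x)) = sgn x"
proof -
  have pos: "sin (pi * y) > 0" if "0 < y" "y < 1" for y :: real
    using that by (intro sin_gt_zero) auto
  show ?thesis using pos[of x] pos[of "- x"] assms by (cases x "0::real" rule: linorder_cases) auto
qed

lemma cross2_polar:
  "cross2 (of_real r * (\<i> * cis a)) (of_real r' * (\<i> * cis b)) = r * r' * sin (b - a)"
  by (simp add: cross2_eq sin_diff algebra_simps)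

text \<open>A chord is perpendicular to the direction of its mean angle. In this form
  \<open>cross2_polar\<close> turns cross products into sines.\<close>

lemma circ_diff_polar: "circ s - circ t = of_real (2 * sin (pi * (s - t))) * (\<i> * cis (pi * (t + s)))"
proof -
  have "2 * pi * s = pi * (t + s) + pi * (s - t)" "2 * pi * t = pi * (t + s) - pi * (s - t)"
    by (simp_all add: algebra_simps)
  then show ?thesis unfolding circ_def
    by (simp only: complex_eq_iff cis.sel cos_add sin_add cos_diff sin_diff minus_complex.sel) simp
qed

text \<open>The lift, with values in \<open>(t, t + 1)\<close>, of the map sending a point of the circle to the other
  endpoint of its chord through \<open>X\<close>; this map is \<open>u \<mapsto> (X - u) / (1 - cnj X * u)\<close>.\<close>

definition half_turn :: "complex \<Rightarrow> real \<Rightarrow> real" where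
  "half_turn X t = t + 1/2 - Arg (1 - cnj X * circ t) / pi"

lemma Re_one_minus_pos:
  assumes "X \<in> diskD"
  shows "Re (1 - cnj X * circ t) > 0"
proof -
  have "Re (cnj X * circ t) \<le> norm (cnj X * circ t)" by (rule complex_Re_le_cmod)
  also have "\<dots> < 1" using assms by (simp add: norm_mult circ_def diskD_def)
  finally show ?thesis by simp
qed

lemma half_turn_bounds:
  assumes "X \<in> diskD"
  shows "t < half_turn X t" "half_turn X t < t + 1"
proof -
  have "\<bar>Arg (1 - cnj X * circ t)\<bar> < pi / 2"
    using Re_one_minus_pos[OF assms] by (simp only: Arg_Re_pos simp_thms)
  then have "\<bar>Arg (1 - cnj X * circ t) / pi\<bar> < 1/2" by (simp add: field_simps)
  then show "t < half_turn X t" "half_turn X t < t + 1" unfolding half_turn_def by linarith+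
qed

lemma half_turn_factor_polar:
  assumes "X \<in> diskD"
  shows "\<exists>r>0. 1 - cnj X * circ t = of_real r * cis (pi * (t + 1/2 - half_turn X t))"
proof (intro exI conjI)
  let ?z = "1 - cnj X * circ t"
  have "?z \<noteq> 0" using Re_one_minus_pos[OF assms, of t] by (metis less_irrefl zero_complex.sel(1))
  then show "norm ?z > 0" by (rule zero_less_norm_iff[THEN iffD2])
  have "pi * (t + 1/2 - half_turn X t) = Arg ?z" by (simp add: half_turn_def)
  then show "?z = of_real (norm ?z) * cis (pi * (t + 1/2 - half_turn X t))"
    using rcis_cmod_Arg[of ?z] by (simp add: rcis_def)
qed

lemma circ_mult_cnj: "circ t * cnj (circ t) = 1"
  by (simp add: circ_def cis_cnj cis_mult)

text \<open>This is the polar form of the chord from \<open>circ t\<close> to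
  \<open>circ (half_turn X t)\<close> up to a positive factor, so the ray from \<open>circ t\<close>
  through \<open>X\<close> leaves the disk at that endpoint.\<close>

lemma half_turn_polar:
  assumes "X \<in> diskD"
  shows "\<exists>r>0. X - circ t = of_real r * (\<i> * cis (pi * (t + half_turn X t)))"
proof -
  obtain r where r: "r > 0" "1 - cnj X * circ t = of_real r * cis (pi * (t + 1/2 - half_turn X t))"
    using half_turn_factor_polar[OF assms] by blast
  have "X - circ t = - circ t * cnj (1 - cnj X * circ t)"
    using circ_mult_cnj[of t] by (simp add: algebra_simps)
  also have "\<dots> = of_real r * (- circ t * cis (- (pi * (t + 1/2 - half_turn X t))))"
    unfolding r(2) by (simp add: cis_cnj)
  also have "- circ t * cis (- (pi * (t + 1/2 - half_turn X t)))
      = cis pi * cis (2 * pi * t) * cis (- (pi * (t + 1/2 - half_turn X t)))"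
    by (simp add: circ_def)
  also have "\<dots> = cis (pi / 2) * cis (pi * (t + half_turn X t))"
    unfolding cis_mult by (rule arg_cong[of _ _ cis]) (simp add: field_simps)
  also have "cis (pi / 2) = \<i>" by simp
  finally show ?thesis using r(1) by blast
qed

lemma circ_half_turn:
  assumes "X \<in> diskD"
  shows "circ (half_turn X t) * (1 - cnj X * circ t) = X - circ t"
proof -
  obtain r where r: "r > 0" "1 - cnj X * circ t = of_real r * cis (pi * (t + 1/2 - half_turn X t))"
    using half_turn_factor_polar[OF assms] by blast
  have e: "X - circ t = - circ t * cnj (1 - cnj X * circ t)"
    using circ_mult_cnj[of t] by (simp add: algebra_simps)
  have "- circ t * cis (- (pi * (t + 1/2 - half_turn X t)))
      = cis pi * cis (2 * pi * t) * cis (- (pi * (t + 1/2 - half_turn X t)))"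
    by (simp add: circ_def)
  also have "\<dots> = cis (2 * pi * half_turn X t) * cis (pi * (t + 1/2 - half_turn X t))"
    unfolding cis_mult by (rule arg_cong[of _ _ cis]) (simp add: field_simps)
  finally show ?thesis unfolding e unfolding r(2)
    by (simp add: cis_cnj circ_def mult.left_commute[of _ "complex_of_real r"])
qed

text \<open>The factor from the chord is positive and the other sine has argument between -\<pi> and
  \<pi>, so the order of the lifts tells on which side of the chord \<open>X\<close> lies.\<close>

lemma sgn_cross2_chord:
  assumes "X \<in> diskD" "t < s" "s < t + 1"
  shows "sgn (cross2 (circ s - circ t) (X - circ t)) = sgn (half_turn X t - s)"
proof -
  obtain r where r: "r > 0" "X - circ t = of_real r * (\<i> * cis (pi * (t + half_turn X t)))"
    using half_turn_polar[OF assms(1)] by blast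
  have "cross2 (circ s - circ t) (X - circ t)
    = 2 * sin (pi * (s - t)) * r * sin (pi * (half_turn X t - s))"
    unfolding r(2) circ_diff_polar cross2_polar by (simp add: algebra_simps)
  moreover have "sin (pi * (s - t)) > 0" using assms by (intro sin_gt_zero) auto
  moreover have "\<bar>half_turn X t - s\<bar> < 1" using half_turn_bounds[OF assms(1), of t] assms by linarith
  ultimately show ?thesis using r(1) sgn_sin_pi by (simp add: sgn_mult)
qed

lemma sgn_cross2_points:
  assumes "X \<in> diskD" "Y \<in> diskD"
  shows "sgn (cross2 (X - circ t) (Y - circ t)) = sgn (half_turn Y t - half_turn X t)"
proof -
  obtain r r' where r: "r > 0" "X - circ t = of_real r * (\<i> * cis (pi * (t + half_turn X t)))"
     "r' > 0" "Y - circ t = of_real r' * (\<i> * cis (pi * (t + half_turn Y t)))"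
    using half_turn_polar assms by meson
  have "cross2 (X - circ t) (Y - circ t) = r * r' * sin (pi * (half_turn Y t - half_turn X t))"
    unfolding r(2,4) cross2_polar by (simp add: algebra_simps)
  moreover have "\<bar>half_turn Y t - half_turn X t\<bar> < 1"
    using half_turn_bounds[OF assms(1), of t] half_turn_bounds[OF assms(2), of t] by linarith
  ultimately show ?thesis using r sgn_sin_pi by (simp add: sgn_mult)
qed

lemma half_turn_add_one: "half_turn X (t + 1) = half_turn X t + 1"
  using circ_add_int[of t 1] by (simp add: half_turn_def)

text \<open>From its other end the chord leads back to \<open>circ t\<close>; two steps of length
  strictly between 0 and 1 can only reach the lift \<open>t + 1\<close>.\<close>

lemma half_turn_twice:
  assumes "X \<in> diskD"
  shows "half_turn X (half_turn X t) = t + 1"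
proof -
  let ?s = "half_turn X t" and ?w = "half_turn X (half_turn X t)"
  note b = half_turn_bounds[OF assms, of t] half_turn_bounds[OF assms, of ?s]
  have "cross2 (circ ?s - circ t) (X - circ t) = 0"
    using sgn_cross2_chord[OF assms b(1,2)] by (simp add: sgn_0_0)
  then have "cross2 (circ (t + 1) - circ ?s) (X - circ ?s) = 0"
    using circ_add_int[of t 1] by (simp add: cross2_eq algebra_simps)
  then show ?thesis using sgn_cross2_chord[OF assms, of ?s "t + 1"] b by (simp add: sgn_0_0)
qed

lemma continuous_on_half_turn:
  assumes "X \<in> diskD"
  shows "continuous_on A (half_turn X)"
proof -
  have "1 - cnj X * circ t \<notin> \<real>\<^sub>\<le>\<^sub>0" for t
    using Re_one_minus_pos[OF assms, of t] by (auto simp: complex_nonpos_Reals_iff)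
  then show ?thesis unfolding half_turn_def[abs_def] by (intro continuous_intros) auto
qed

text \<open>\<open>half_turn_twice\<close> gives injectivity, and a continuous injective function is
  monotone; growth over \<open>n\<close> full turns fixes the direction.\<close>

lemma strict_mono_half_turn:
  assumes "X \<in> diskD"
  shows "strict_mono (half_turn X)"
proof (rule strict_monoI)
  fix s t :: real assume "s < t"
  define n where "n = nat \<lceil>t - s\<rceil> + 1"
  have n: "t < s + real n" unfolding n_def by linarith
  have "half_turn X (s + real n) = half_turn X s + real n" for n
  proof (induction n)
    case (Suc n)
    then show ?case using half_turn_add_one[of X "s + real n"] by (simp add: algebra_simps)
  qed simp
  then have big: "half_turn X s < half_turn X (s + real n)" using n \<open>s < t\<close> by simp
  have "inj_on (half_turn X) {s..s + real n}"
    by (rule inj_onI) (metis half_turn_twice[OF assms] add_right_cancel)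
  then show "half_turn X s < half_turn X t"
    using continuous_inj_imp_mono[OF \<open>s < t\<close> n continuous_on_half_turn[OF assms]] big
    by auto
qed

text \<open>\<open>P\<close> lies between the two endpoints of the chord, so these cannot both be on the far side of
  the line \<open>QR\<close>.\<close>

lemma chord_not_beyond_opposite_side:
  assumes PQR: "P \<in> diskD" "Q \<in> diskD" "R \<in> diskD" and ccw: "cross2 (Q - P) (R - P) > 0"
    and "half_turn R t \<le> half_turn Q t"
    and "half_turn R (half_turn P t) \<le> half_turn Q (half_turn P t)"
  shows False
proof -
  let ?s = "half_turn P t"
  \<comment> \<open>\<open>f\<close> is affine because its quadratic part cancels, so its value at
    \<open>P\<close> is a weighted mean of its values at the two chord endpoints.\<close>
  define f where "f = (\<lambda>x. cross2 (Q - x) (R - x))"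
  obtain r where r: "r > 0" "P - circ t = of_real r * (\<i> * cis (pi * (t + ?s)))"
    using half_turn_polar[OF PQR(1)] by blast
  obtain r' where r': "r' > 0" "P - circ ?s = of_real r' * (\<i> * cis (pi * (?s + (t + 1))))"
    using half_turn_polar[OF PQR(1), of ?s] unfolding half_turn_twice[OF PQR(1)] by blast
  have "cis (pi * (?s + (t + 1))) = cis pi * cis (pi * (t + ?s))"
    unfolding cis_mult by (rule arg_cong[of _ _ cis]) (simp add: algebra_simps)
  then have eq: "r' *\<^sub>R (P - circ t) + r *\<^sub>R (P - circ ?s) = 0"
    unfolding r(2) r'(2) by (simp add: scaleR_conv_of_real)
  have "(r + r') * f P = r' * f (circ t) + r * f (circ ?s)"
  proof -
    have "r' * (Re P - Re (circ t)) + r * (Re P - Re (circ ?s)) = 0"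
      "r' * (Im P - Im (circ t)) + r * (Im P - Im (circ ?s)) = 0"
      using eq by (auto simp: complex_eq_iff)
    then show ?thesis unfolding f_def cross2_eq minus_complex.sel by algebra
  qed
  moreover have "f (circ t) \<le> 0" "f (circ ?s) \<le> 0"
    using sgn_cross2_points[OF PQR(2,3), of t] sgn_cross2_points[OF PQR(2,3), of ?s] assms(5,6)
    unfolding f_def by (smt (verit) sgn_greater sgn_pos)+
  moreover have "f P > 0" using ccw by (simp add: f_def)
  ultimately show False using r(1) r'(1)
    by (smt (verit) mult_nonneg_nonpos mult_pos_pos)
qed

text \<open>Closed half-planes are convex, which gives the inequality; open ones are convex too, so
  a zero on the hull forces one at a vertex.\<close>

lemma cross2_hull_nonneg_iff:
  "(\<forall>x\<in>convex hull T. cross2 a (x - v) \<ge> 0) \<and> (\<exists>x\<in>convex hull T. cross2 a (x - v) = 0)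
    \<longleftrightarrow> (\<forall>x\<in>T. cross2 a (x - v) \<ge> 0) \<and> (\<exists>x\<in>T. cross2 a (x - v) = 0)"
proof -
  have inner: "cross2 a (x - v) = (\<i> * a) \<bullet> x - (\<i> * a) \<bullet> v" for x
    by (simp add: cross2_eq inner_complex_def algebra_simps)
  have ge: "convex hull T \<subseteq> {x. cross2 a (x - v) \<ge> 0}" if "\<forall>x\<in>T. cross2 a (x - v) \<ge> 0"
    using that by (intro hull_minimal) (auto simp: inner convex_halfspace_ge)
  have gt: "convex hull T \<subseteq> {x. cross2 a (x - v) > 0}" if "\<forall>x\<in>T. cross2 a (x - v) > 0"
    using that by (intro hull_minimal) (auto simp: inner convex_halfspace_gt)
  have sub: "x \<in> convex hull T" if "x \<in> T" for x using that by (rule hull_inc)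
  show ?thesis
  proof safe
    fix x assume *: "\<forall>x\<in>convex hull T. cross2 a (x - v) \<ge> 0" "x \<in> convex hull T" "cross2 a (x - v) = 0"
    show "\<exists>x\<in>T. cross2 a (x - v) = 0"
    proof (rule ccontr)
      assume "\<not> ?thesis"
      then have "\<forall>x\<in>T. cross2 a (x - v) > 0" using *(1) sub by (force simp: less_le)
      from gt[OF this] * show False by auto
    qed
  qed (use ge sub in auto)
qed

section \<open>The dynamics of the triangle map\<close>

locale ccw_triangle =
  fixes P Q R :: complex
  assumes P: "P \<in> diskD" and Q: "Q \<in> diskD" and R: "R \<in> diskD"
    and ccw: "cross2 (Q - P) (R - P) > 0"
begin

abbreviation "p \<equiv> half_turn P"
abbreviation "q \<equiv> half_turn Q"
abbreviation "r \<equiv> half_turn R"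
abbreviation "\<psi> \<equiv> tri_psi P Q R"

section \<open>The lift of the triangle map\<close>

definition F :: "real \<Rightarrow> real" where
  "F t = min (p t) (min (q t) (r t))"

lemma F_le: "F t \<le> p t" "F t \<le> q t" "F t \<le> r t"
  by (auto simp: F_def)

lemma F_cases: "F t = p t \<or> F t = q t \<or> F t = r t"
  by (auto simp: F_def min_def)

lemmas less = P[THEN strict_mono_half_turn, THEN strict_mono_less]
  Q[THEN strict_mono_half_turn, THEN strict_mono_less]
  R[THEN strict_mono_half_turn, THEN strict_mono_less]

lemmas less_eq = P[THEN strict_mono_half_turn, THEN strict_mono_less_eq]
  Q[THEN strict_mono_half_turn, THEN strict_mono_less_eq]
  R[THEN strict_mono_half_turn, THEN strict_mono_less_eq]

lemmas twice = P[THEN half_turn_twice] Q[THEN half_turn_twice] R[THEN half_turn_twice]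

lemmas bounds = P[THEN half_turn_bounds(1)] Q[THEN half_turn_bounds(1)] R[THEN half_turn_bounds(1)]
  P[THEN half_turn_bounds(2)] Q[THEN half_turn_bounds(2)] R[THEN half_turn_bounds(2)]

sublocale circle_lift F
proof
  show "continuous_on UNIV F" unfolding F_def[abs_def]
    by (intro continuous_intros continuous_on_half_turn P Q R)
  show "strict_mono F"
    by (rule strict_monoI) (auto simp: F_def min_less_iff_disj less)
  show "F (t + 1) = F t + 1" for t by (simp add: F_def half_turn_add_one)
  show "F t > t" for t by (simp add: F_def bounds)
qed

lemma F_less: "F t < t + 1"
  using F_le(1)[of t] bounds(4)[of t] by linarith

text \<open>A triangle to the left of the chord makes \<open>s\<close> the least of the three
  half-turn lifts, one to the right the greatest; touching means equality at some vertex.\<close>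

lemma supports_chord_iff:
  assumes "t < s" "s < t + 1"
  shows "supports_chord (circ t) (circ s) (convex hull {P, Q, R}) \<longleftrightarrow>
    s = F t \<or> s = max (p t) (max (q t) (r t))"
proof -
  have "circ s \<noteq> circ t" using circ_eq_imp_eq[of s t] assms by auto
  let ?T = "{P, Q, R}" and ?a = "circ s - circ t"
  have pos: "cross2 ?a (X - circ t) \<ge> 0 \<longleftrightarrow> half_turn X t \<ge> s"
    and neg: "- cross2 ?a (X - circ t) \<ge> 0 \<longleftrightarrow> half_turn X t \<le> s"
    and zero: "cross2 ?a (X - circ t) = 0 \<longleftrightarrow> half_turn X t = s" if "X \<in> diskD" for X
    using sgn_cross2_chord[OF that assms] by (auto simp: sgn_if split: if_splits)
  have minus: "cross2 (- ?a) x = - cross2 ?a x" for x by (simp add: cross2_eq algebra_simps)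
  have "supports_chord (circ t) (circ s) (convex hull ?T) \<longleftrightarrow>
    ((\<forall>x\<in>convex hull ?T. cross2 ?a (x - circ t) \<ge> 0) \<and> (\<exists>x\<in>convex hull ?T. cross2 ?a (x - circ t) = 0)) \<or>
    ((\<forall>x\<in>convex hull ?T. cross2 (- ?a) (x - circ t) \<ge> 0) \<and> (\<exists>x\<in>convex hull ?T. cross2 (- ?a) (x - circ t) = 0))"
    using \<open>circ s \<noteq> circ t\<close> unfolding supports_chord_def minus by auto
  also have "\<dots> \<longleftrightarrow>
    ((\<forall>x\<in>?T. cross2 ?a (x - circ t) \<ge> 0) \<and> (\<exists>x\<in>?T. cross2 ?a (x - circ t) = 0)) \<or>
    ((\<forall>x\<in>?T. cross2 (- ?a) (x - circ t) \<ge> 0) \<and> (\<exists>x\<in>?T. cross2 (- ?a) (x - circ t) = 0))"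
    by (simp only: cross2_hull_nonneg_iff)
  also have "\<dots> \<longleftrightarrow> (s \<le> p t \<and> s \<le> q t \<and> s \<le> r t \<or> p t \<le> s \<and> q t \<le> s \<and> r t \<le> s)
      \<and> (p t = s \<or> q t = s \<or> r t = s)"
    by (simp only: minus ball_simps bex_simps pos neg zero neg_equal_0_iff_equal P Q R) blast
  also have "\<dots> \<longleftrightarrow> s = F t \<or> s = max (p t) (max (q t) (r t))"
    by (auto simp: F_def min_def max_def)
  finally show ?thesis .
qed

text \<open>Of the two support chords, the one at the minimum is met first counterclockwise.\<close>

lemma psi_circ: "\<psi> (circ t) = circ (F t)"
proof -
  let ?S = "\<lambda>w. supports_chord (circ t) w (convex hull {P, Q, R})"
  let ?M = "max (p t) (max (q t) (r t))"
  have F: "?S (circ (F t))" using supports_chord_iff[OF greater F_less] by blast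
  have far: "ccw_dist (circ t) (circ (F t)) < ccw_dist (circ t) w" if w: "?S w" "w \<noteq> circ (F t)" for w
  proof -
    have "w \<in> circleS" "w \<noteq> circ t" using w(1) by (auto simp: supports_chord_def)
    then obtain s where s: "t \<le> s" "s < t + 1" "circ s = w" using circ_surj by blast
    then have "t < s" using \<open>w \<noteq> circ t\<close> by (auto simp: less_le)
    then have "s = ?M" using w s supports_chord_iff[of t s] by auto
    moreover have "F t \<noteq> s" using w s by auto
    ultimately have "F t < s" unfolding F_def by linarith
    then show ?thesis
      using s \<open>t < s\<close> greater[of t] F_less[of t] by (simp add: ccw_dist_circ flip: s(3))
  qed
  show ?thesis unfolding tri_psi_def
  proof (rule the_equality)
    show "?S (circ (F t)) \<and> (\<forall>w'. ?S w' \<and> w' \<noteq> circ (F t) \<longrightarrow>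
        ccw_dist (circ t) (circ (F t)) < ccw_dist (circ t) w')" using F far by blast
    fix w assume "?S w \<and> (\<forall>w'. ?S w' \<and> w' \<noteq> w \<longrightarrow> ccw_dist (circ t) w < ccw_dist (circ t) w')"
    then show "w = circ (F t)" using F far by (metis less_asym)
  qed
qed

lemma funpow_psi_circ: "(\<psi> ^^ n) (circ t) = circ ((F ^^ n) t)"
  by (induction n) (auto simp: psi_circ)

lemma psi_tendsto:
  assumes "(\<lambda>n. (ret ^^ n) t) \<longlonglongrightarrow> y"
  shows "(\<lambda>n. (\<psi> ^^ (3 * n)) (circ t)) \<longlonglongrightarrow> circ y"
proof -
  have "circ ((ret ^^ n) t) = (\<psi> ^^ (3 * n)) (circ t)" for n
    using circ_add_int[of "(F ^^ (3 * n)) t" "- int n"] by (simp add: funpow_ret funpow_psi_circ)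
  moreover have "(\<lambda>n. circ ((ret ^^ n) t)) \<longlonglongrightarrow> circ y"
    using continuous_on_circ[OF continuous_on_id, of UNIV] assms
    by (intro isCont_tendsto_compose[of y circ]) (auto simp: continuous_on_eq_continuous_at)
  ultimately show ?thesis by simp
qed

text \<open>A support line through both \<open>P\<close> and \<open>Q\<close> overshoots.\<close>

lemma ret_greater_exists: "\<exists>t. ret t > t"
proof -
  obtain v where v: "v \<in> circleS" "collinear {P, Q, v}" using chord_endpoints_exist[OF P] by blast
  obtain t where t: "v = circ t" using circ_surj[OF v(1)] by blast
  have "cross2 (P - v) (Q - v) = 0"
    using v(2) unfolding collinear_iff_cross2 by (simp add: cross2_eq algebra_simps)
  then have pq: "p t = q t" using sgn_cross2_points[OF P Q, of t] by (simp add: t sgn_0_0)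
  \<comment> \<open>The line \<open>PQ\<close> has two ends. If \<open>R\<close> comes before
    \<open>P\<close> as seen from \<open>t\<close>, it comes after \<open>P\<close> as seen from the
    other end \<open>p t\<close>.\<close>
  obtain t0 where t0: "p t0 = q t0" "p t0 \<le> r t0"
  proof (cases "p t \<le> r t")
    case False
    then have "r (r t) < r (p t)" by (simp add: less)
    then have "p (p t) \<le> r (p t)" by (simp add: twice)
    moreover have "p (p t) = q (p t)" using pq twice(1,2)[of t] by simp
    ultimately show ?thesis using that by blast
  qed (use pq that in blast)
  define s where "s = p t0"
  have s: "F t0 = s" "p s = t0 + 1" "q s = t0 + 1" "t0 < s"
    using t0 twice(1,2)[of t0] bounds(1)[of t0] by (auto simp: s_def F_def)
  define x where "x = F s"
  have x: "x > s" "x = t0 + 1 \<or> x = r s"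
    unfolding x_def using greater[of s] s(2,3) by (auto simp: F_def min_def)
  \<comment> \<open>\<open>p\<close> and \<open>q\<close> take \<open>s\<close> to
    \<open>t0 + 1\<close>, and \<open>x > s\<close>. For \<open>r\<close>, either
    \<open>x = t0 + 1\<close> is moved forward, or \<open>x = r s\<close> returns to
    \<open>s + 1\<close>.\<close>
  have "p x > t0 + 1" "q x > t0 + 1" using x(1) less(1)[of s x] less(2)[of s x] s by auto
  moreover have "r x > t0 + 1" using x(2) bounds(3)[of x] twice(3)[of s] s by auto
  ultimately have "F x > t0 + 1" by (simp add: F_def)
  then have "ret t0 > t0" by (simp add: ret_def x_def s(1))
  then show ?thesis by blast
qed

section \<open>Three-periodic orbits\<close>

text \<open>Two consecutive steps through the same vertex would close the orbit after two steps
  instead of three; the third and first steps are consecutive cyclically.\<close>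

lemma F_vertices_distinct:
  assumes X: "X \<in> diskD" and t: "ret t = t" "F t = half_turn X t"
  shows "F (F t) \<noteq> half_turn X (F t)" "F (F (F t)) \<noteq> half_turn X (F (F t))"
proof -
  have t3: "F (F (F t)) = t + 1" using t by (simp add: ret_def)
  show "F (F t) \<noteq> half_turn X (F t)"
  proof
    assume "F (F t) = half_turn X (F t)"
    then have "F (F t) = t + 1" using t(2) half_turn_twice[OF X, of t] by simp
    then show False using t3 greater[of "t + 1"] by simp
  qed
  show "F (F (F t)) \<noteq> half_turn X (F (F t))"
  proof
    assume "F (F (F t)) = half_turn X (F (F t))"
    then have "half_turn X (F (F t)) = half_turn X (half_turn X t)"
      using t3 half_turn_twice[OF X, of t] by simp
    then have "F (F t) = F t" using strict_mono_eq[OF strict_mono_half_turn[OF X]] t(2) by metis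
    then show False using greater[of "F t"] by simp
  qed
qed

lemma ret_fixed_through_P:
  assumes t: "ret t = t" and "F t = p t"
  shows "r (q (p t)) = t + 1"
proof -
  have t3: "F (F (F t)) = t + 1" using t by (simp add: ret_def)
  have Ft: "ret (F t) = F t" using t by (simp add: ret_F)
  note no_p = F_vertices_distinct[OF P assms]
  have "F (F t) = q (F t) \<and> F (F (F t)) = r (F (F t)) \<or> F (F t) = r (F t) \<and> F (F (F t)) = q (F (F t))"
    using F_cases[of "F t"] F_cases[of "F (F t)"] no_p F_vertices_distinct(1)[OF Q Ft]
      F_vertices_distinct(1)[OF R Ft] by auto
  then show ?thesis
  proof
    \<comment> \<open>In the reverse order, both ends of the chord through \<open>P\<close> would
      see \<open>R\<close> no later than \<open>Q\<close>.\<close>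
    assume rev: "F (F t) = r (F t) \<and> F (F (F t)) = q (F (F t))"
    have "r (p t) \<le> q (p t)" using rev F_le(2)[of "F t"] assms(2) by simp
    moreover have "r t \<le> q t"
    proof -
      have "q (F (F t)) = q (q t)" using rev t3 twice(2)[of t] by simp
      then have "F (F t) = q t" by (metis less(2) linorder_neq_iff)
      then have "r (r t) \<le> r (q t)" using F_le(3)[of "q t"] t3 twice(3)[of t] by simp
      then show ?thesis by (simp add: less_eq)
    qed
    ultimately show ?thesis using chord_not_beyond_opposite_side[OF P Q R ccw] by blast
  qed (use assms(2) t3 in auto)
qed

text \<open>Neither \<open>Q\<close> nor \<open>R\<close> serves two of the three steps, so some
  step uses \<open>P\<close>; from there the order is forced.\<close>

lemma ret_fixed_orbit:
  assumes t: "ret t = t"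
  shows "\<exists>s\<in>{t, F t, F (F t)}. r (q (p s)) = s + 1"
proof -
  have fixed: "ret (F t) = F t" "ret (F (F t)) = F (F t)" using t by (simp_all add: ret_F)
  have "F t = p t \<or> F (F t) = p (F t) \<or> F (F (F t)) = p (F (F t))"
    using F_cases[of t] F_cases[of "F t"] F_cases[of "F (F t)"] F_vertices_distinct[OF Q t]
      F_vertices_distinct[OF R t] F_vertices_distinct(1)[OF Q fixed(1)]
      F_vertices_distinct(1)[OF R fixed(1)] by auto
  then show ?thesis using ret_fixed_through_P t fixed by blast
qed

text \<open>A triple composition reaching \<open>t + 2\<close> would close up the reversed triangle, in the order
  \<open>R, Q, P\<close>.\<close>

lemma triple_less: "r (q (p t)) < t + 2"
proof (rule ccontr)
  assume "\<not> r (q (p t)) < t + 2"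
  moreover have "r (r t + 1) = t + 2" using twice(3)[of t] by (simp add: half_turn_add_one)
  ultimately have "r t + 1 \<le> q (p t)" by (smt (verit) less(3))
  then have "q (q (r t)) \<le> q (p t)" by (simp add: twice)
  then have "q (r t) \<le> p t" by (simp add: less_eq)
  moreover have "p t < p (r t)" "q t < q (r t)" using bounds(3) by (simp_all add: less)
  moreover have "cross2 (P - R) (Q - R) > 0" using ccw by (simp add: cross2_eq algebra_simps)
  ultimately show False using chord_not_beyond_opposite_side[OF R P Q, of t] by simp
qed

section \<open>The Moebius composition and its fixed points\<close>

definition B :: complex where "B = P - Q + R - R * cnj Q * P"
definition K :: real where "K = Re (cnj Q * P + cnj R * Q - cnj R * P) - 1"
text \<open>On the circle, minus the real part of the product of the three denominators
  \<open>1 - cnj X * u\<close>, taken along \<open>u\<close> and its first two images. The product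
  is affine in \<open>u\<close>, which yields \<open>B\<close> and \<open>K\<close>.\<close>

definition h :: "complex \<Rightarrow> real" where "h u = Re (cnj B * u) + K"

text \<open>The arguments of the factors telescope, so \<open>h\<close> is a positive multiple of a
  sine; \<open>triple_less\<close> keeps its argument between -\<pi> and \<pi>.\<close>

lemma sgn_h: "sgn (h (circ t)) = sgn (t + 1 - r (q (p t)))"
proof -
  let ?z1 = "1 - cnj P * circ t" and ?z2 = "1 - cnj Q * circ (p t)" and ?z3 = "1 - cnj R * circ (q (p t))"
  obtain k1 where k1: "k1 > 0" "?z1 = of_real k1 * cis (pi * (t + 1/2 - p t))"
    using half_turn_factor_polar[OF P] by blast
  obtain k2 where k2: "k2 > 0" "?z2 = of_real k2 * cis (pi * (p t + 1/2 - q (p t)))"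
    using half_turn_factor_polar[OF Q] by blast
  obtain k3 where k3: "k3 > 0" "?z3 = of_real k3 * cis (pi * (q (p t) + 1/2 - r (q (p t))))"
    using half_turn_factor_polar[OF R] by blast
  have u2: "circ (p t) * ?z1 = P - circ t" and u3: "circ (q (p t)) * ?z2 = Q - circ (p t)"
    using circ_half_turn P Q by blast+
  \<comment> \<open>Each image occurs only multiplied by its own denominator and is eliminated by
    \<open>u3\<close> and then \<open>u2\<close>.\<close>
  have "?z1 * ?z2 * ?z3 = ?z1 - cnj Q * (circ (p t) * ?z1) - cnj R * (circ (q (p t)) * ?z2) * ?z1"
    by (simp add: algebra_simps)
  also have "\<dots> = ?z1 - cnj Q * (circ (p t) * ?z1) - cnj R * (Q * ?z1 - circ (p t) * ?z1)"
    unfolding u3 by (simp add: algebra_simps)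
  also have "\<dots> = ?z1 - cnj Q * (P - circ t) - cnj R * (Q * ?z1 - (P - circ t))"
    unfolding u2 ..
  also have "Re \<dots> = - h (circ t)" by (simp add: h_def B_def K_def algebra_simps)
  finally have h: "h (circ t) = - Re (?z1 * ?z2 * ?z3)" by simp
  have "?z1 * ?z2 * ?z3 = of_real (k1 * k2 * k3) * (cis (pi * (t + 1/2 - p t)) *
      cis (pi * (p t + 1/2 - q (p t))) * cis (pi * (q (p t) + 1/2 - r (q (p t)))))"
    unfolding k1(2) k2(2) k3(2) by (simp add: mult_ac)
  also have "cis (pi * (t + 1/2 - p t)) * cis (pi * (p t + 1/2 - q (p t))) *
      cis (pi * (q (p t) + 1/2 - r (q (p t)))) = cis (pi * (t + 1 - r (q (p t))) + pi / 2)"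
    unfolding cis_mult by (rule arg_cong[of _ _ cis]) (simp add: algebra_simps)
  finally have "h (circ t) = k1 * k2 * k3 * sin (pi * (t + 1 - r (q (p t))))"
    unfolding h by (simp add: cos_add)
  moreover have "\<bar>t + 1 - r (q (p t))\<bar> < 1"
    using triple_less[of t] bounds(1)[of t] bounds(2)[of "p t"] bounds(3)[of "q (p t)"] by linarith
  ultimately show ?thesis using k1 k2 k3 by (simp add: sgn_mult sgn_sin_pi)
qed

lemma h_zero_iff: "h (circ t) = 0 \<longleftrightarrow> r (q (p t)) = t + 1"
  using sgn_h[of t] by (auto simp: sgn_if split: if_splits)

lemma ret_le_triple: "ret t \<le> r (q (p t)) - 1"
proof -
  have "F (F (F t)) \<le> F (F (p t))" by (simp add: F_le)
  also have "\<dots> \<le> F (q (p t))" by (simp add: F_le)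
  also have "\<dots> \<le> r (q (p t))" by (rule F_le)
  finally show ?thesis by (simp add: ret_def)
qed

text \<open>The sign of the left side decides whether the line \<open>h u = 0\<close> is tangent or
  secant to the circle; the right side is the quantity compared in
  \<open>delta_Deltaprime\<close>.\<close>

lemma discriminant:
  "(norm B)\<^sup>2 - K\<^sup>2 = (cross2 (Q - P) (R - P))\<^sup>2 - mink P P * mink Q Q * mink R R"
  unfolding cmod_power2 B_def K_def mink_def cross2_eq inner_complex_def by simp algebra

lemma ret_fixed_zero:
  assumes "ret t = t"
  shows "\<exists>s\<in>{t, F t, F (F t)}. h (circ s) = 0"
  using ret_fixed_orbit[OF assms] by (auto simp: h_zero_iff)

text \<open>The two orbits interlace, and their six points lie in the half-open period from
  \<open>a\<close> to \<open>a + 1\<close>, where \<open>circ\<close> is injective.\<close>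

lemma orbits_circ_distinct:
  assumes "ret a = a" and "a \<le> b" "b < c" "c < F a"
    and x: "x \<in> {b, F b, F (F b)}" and y: "y \<in> {c, F c, F (F c)}"
  shows "circ x \<noteq> circ y"
proof -
  have a3: "F (F (F a)) = a + 1" using assms by (simp add: ret_def)
  have chain: "F a \<le> F b" "F b < F c" "F c < F (F a)" "F (F a) \<le> F (F b)" "F (F b) < F (F c)"
    "F (F c) < a + 1"
    using assms by (auto simp flip: a3)
  have xs: "x = b \<or> x = F b \<or> x = F (F b)" and ys: "y = c \<or> y = F c \<or> y = F (F c)"
    using x y by auto
  from xs ys have "\<bar>x - y\<bar> < 1" using assms(2-4) chain by (elim disjE) linarith+
  moreover from xs ys have "x \<noteq> y" using assms(2-4) chain by (elim disjE) linarith+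
  ultimately show ?thesis using circ_eq_imp_eq by blast
qed

text \<open>Multiplication by \<open>cnj B\<close> makes the line vertical, leaving only the sign of
  the imaginary part open.\<close>

lemma h_zero_eq:
  assumes "h u = 0" "u \<in> circleS"
  shows "Re (cnj B * u) = - K" "(Im (cnj B * u))\<^sup>2 = (norm B)\<^sup>2 - K\<^sup>2"
proof -
  show re: "Re (cnj B * u) = - K" using assms(1) by (simp add: h_def)
  have "norm (cnj B * u) = norm B" using assms(2) by (simp add: circleS_def norm_mult)
  then have "(Re (cnj B * u))\<^sup>2 + (Im (cnj B * u))\<^sup>2 = (norm B)\<^sup>2"
    using cmod_power2[of "cnj B * u"] by (simp only:)
  then show "(Im (cnj B * u))\<^sup>2 = (norm B)\<^sup>2 - K\<^sup>2" unfolding re by simp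
qed

text \<open>Otherwise \<open>K = 0\<close> and \<open>h\<close> vanishes identically, so
  \<open>r \<circ> q \<circ> p\<close> is translation by 1 and \<open>ret\<close> is nowhere above
  the identity.\<close>

lemma B_nonzero:
  assumes "norm B \<ge> \<bar>K\<bar>"
  shows "B \<noteq> 0"
proof
  assume "B = 0"
  then have "h u = 0" for u using assms by (simp add: h_def)
  moreover obtain t where "ret t > t" using ret_greater_exists by blast
  ultimately show False using ret_le_triple[of t] h_zero_iff[of t] by auto
qed

lemma max_of_h: "B \<noteq> 0 \<Longrightarrow> \<exists>t. h (circ t) = norm B + K"
proof -
  assume "B \<noteq> 0"
  then have "sgn B \<in> circleS" by (simp add: circleS_def norm_sgn)
  then obtain t where "circ t = sgn B" using circ_surj by blast
  moreover have "cnj B * sgn B = of_real (norm B)"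
    using \<open>B \<noteq> 0\<close> complex_norm_square[of B]
    by (simp add: sgn_div_norm scaleR_conv_of_real field_simps power2_eq_square)
  ultimately show ?thesis by (intro exI[of _ t]) (simp add: h_def)
qed

section \<open>Tangent and secant fixed-point lines\<close>

lemma parabolic_case:
  assumes "norm B = \<bar>K\<bar>"
  shows "\<exists>a. ret a = a \<and> (\<forall>v. a < v \<and> v \<le> F a \<longrightarrow> (\<lambda>n. (ret ^^ n) v) \<longlonglongrightarrow> F a)"
proof -
  have B: "B \<noteq> 0" using assms by (intro B_nonzero) simp
  \<comment> \<open>By tangency the imaginary part vanishes, so there is at most one zero.\<close>
  have zero: "u = w" if "h u = 0" "u \<in> circleS" "h w = 0" "w \<in> circleS" for u w
  proof -
    have "cnj B * u = cnj B * w"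
      using h_zero_eq[OF that(1,2)] h_zero_eq[OF that(3,4)] assms by (auto simp: complex_eq_iff)
    then show ?thesis using B by simp
  qed
  obtain t0 where t0: "ret t0 > t0" using ret_greater_exists by blast
  \<comment> \<open>Where \<open>h\<close> is maximal, hence nonnegative, \<open>ret\<close> does
    not exceed the identity.\<close>
  obtain t1 where "h (circ t1) = norm B + K" using max_of_h[OF B] by blast
  then have "h (circ t1) \<ge> 0" using assms by simp
  then have "r (q (p t1)) \<le> t1 + 1" using sgn_h[of t1] by (auto simp: sgn_if split: if_splits)
  then have "ret t1 \<le> t1" using ret_le_triple[of t1] by simp
  then obtain a where a: "ret a = a" using ret_fixed_exists[OF t0] by blast
  have "\<forall>c\<in>{a<..<F a}. ret c \<noteq> c"
  proof (intro ballI notI)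
    fix c assume c: "c \<in> {a<..<F a}" "ret c = c"
    obtain x where x: "x \<in> {a, F a, F (F a)}" "h (circ x) = 0" using ret_fixed_zero[OF a] by blast
    obtain y where y: "y \<in> {c, F c, F (F c)}" "h (circ y) = 0" using ret_fixed_zero[OF c(2)] by blast
    have "circ x \<noteq> circ y" by (rule orbits_circ_distinct[OF a _ _ _ x(1) y(1)]) (use c in auto)
    then show False using zero x(2) y(2) by simp
  qed
  from semistable_orbit[OF a this t0] show ?thesis using a by blast
qed

lemma hyperbolic_case:
  assumes "norm B > \<bar>K\<bar>"
  shows "\<exists>a b. ret a = a \<and> ret b = b \<and> a < b \<and> b < F a \<and>
    (\<forall>v. b < v \<and> v < F b \<longrightarrow> (\<lambda>n. (ret ^^ n) v) \<longlonglongrightarrow> F a)"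
proof -
  have B: "B \<noteq> 0" using assms by auto
  \<comment> \<open>Three imaginary parts with a common square cannot be distinct.\<close>
  have zero: "u = v \<or> v = w \<or> u = w" if z: "h u = 0" "h v = 0" "h w = 0"
    "u \<in> circleS" "v \<in> circleS" "w \<in> circleS" for u v w
  proof -
    have "(Im (cnj B * u))\<^sup>2 = (Im (cnj B * v))\<^sup>2" "(Im (cnj B * v))\<^sup>2 = (Im (cnj B * w))\<^sup>2"
      using h_zero_eq(2) z by metis+
    then have "Im (cnj B * u) = Im (cnj B * v) \<or> Im (cnj B * v) = Im (cnj B * w) \<or> Im (cnj B * u) = Im (cnj B * w)"
      by (auto simp only: power2_eq_iff)
    then have "cnj B * u = cnj B * v \<or> cnj B * v = cnj B * w \<or> cnj B * u = cnj B * w"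
      using h_zero_eq(1) z by (metis complex_eqI)
    then show ?thesis using B by simp
  qed
  obtain t0 where t0: "ret t0 > t0" using ret_greater_exists by blast
  obtain t1 where "h (circ t1) = norm B + K" using max_of_h[OF B] by blast
  then have "h (circ t1) > 0" using assms by simp
  then have "r (q (p t1)) < t1 + 1" using sgn_h[of t1] by (auto simp: sgn_if split: if_splits)
  then have t1: "ret t1 < t1" using ret_le_triple[of t1] by simp
  show ?thesis
  proof (rule attracting_repelling_orbits[OF t0 t1])
    fix a b c assume abc: "ret a = a" "ret b = b" "ret c = c" "a < b" "b < c" "c < F a"
    obtain x where x: "x \<in> {a, F a, F (F a)}" "h (circ x) = 0" using ret_fixed_zero abc by blast
    obtain y where y: "y \<in> {b, F b, F (F b)}" "h (circ y) = 0" using ret_fixed_zero abc by blast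
    obtain z where z: "z \<in> {c, F c, F (F c)}" "h (circ z) = 0" using ret_fixed_zero abc by blast
    have "circ x \<noteq> circ y"
      by (rule orbits_circ_distinct[OF abc(1) _ _ _ x(1) y(1)]) (use abc in linarith)+
    moreover have "circ x \<noteq> circ z"
      by (rule orbits_circ_distinct[OF abc(1) _ _ _ x(1) z(1)]) (use abc in linarith)+
    moreover have "circ y \<noteq> circ z"
      by (rule orbits_circ_distinct[OF abc(1) _ _ _ y(1) z(1)]) (use abc in linarith)+
    ultimately show False using zero x(2) y(2) z(2) circ_mem by blast
  qed
qed

section \<open>Transfer to the circle\<close>

lemma circ_F3:
  assumes "ret t = t"
  shows "circ (F (F (F t))) = circ t"
proof -
  have "F (F (F t)) = t + of_int 1" using assms by (simp add: ret_def)
  then show ?thesis by (simp only: circ_add_int)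
qed

text \<open>The interval from \<open>a\<close> to \<open>F a\<close> and its two images become the
  three arcs; the last limit \<open>a + 1\<close> represents \<open>u1\<close> again.\<close>

lemma parabolic_dynamics:
  assumes "norm B = \<bar>K\<bar>"
  shows "\<exists>u1\<in>circleS. (\<psi> ^^ 3) u1 = u1 \<and>
    (\<forall>v\<in>ccw_arc ((\<psi> ^^ 2) u1) u1 - {(\<psi> ^^ 2) u1}. (\<lambda>n. (\<psi> ^^ (3*n)) v) \<longlonglongrightarrow> u1) \<and>
    (\<forall>v\<in>ccw_arc u1 (\<psi> u1) - {u1}. (\<lambda>n. (\<psi> ^^ (3*n)) v) \<longlonglongrightarrow> \<psi> u1) \<and>
    (\<forall>v\<in>ccw_arc (\<psi> u1) ((\<psi> ^^ 2) u1) - {\<psi> u1}. (\<lambda>n. (\<psi> ^^ (3*n)) v) \<longlonglongrightarrow> (\<psi> ^^ 2) u1)"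
proof -
  obtain a where a: "ret a = a" and conv1: "\<forall>v\<in>{a<..F a}. (\<lambda>n. (ret ^^ n) v) \<longlonglongrightarrow> F a"
    using parabolic_case[OF assms] by auto
  then have conv2: "\<forall>v\<in>{F a<..F (F a)}. (\<lambda>n. (ret ^^ n) v) \<longlonglongrightarrow> F (F a)"
    by (intro ballI basin_image[of "{F a<..F (F a)}" "F a"]) auto
  then have conv3: "\<forall>v\<in>{F (F a)<..F (F (F a))}. (\<lambda>n. (ret ^^ n) v) \<longlonglongrightarrow> F (F (F a))"
    by (intro ballI basin_image[of "{F (F a)<..F (F (F a))}" "F (F a)"]) auto
  have arc: "(\<lambda>n. (\<psi> ^^ (3*n)) v) \<longlonglongrightarrow> circ (F x)"
    if conv: "\<forall>v\<in>{x<..F x}. (\<lambda>n. (ret ^^ n) v) \<longlonglongrightarrow> F x"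
      and v: "v \<in> ccw_arc (circ x) (circ (F x)) - {circ x}" for v x
  proof -
    obtain s where "x \<le> s" "s \<le> F x" "v = circ s" "s \<noteq> x"
      using v mem_ccw_arc_circ[of x "F x" v] greater[of x] F_less[of x] by auto
    then show ?thesis using conv psi_tendsto[of s "F x"] by simp
  qed
  have psi2: "(\<psi> ^^ 2) (circ a) = circ (F (F a))" and psi3: "(\<psi> ^^ 3) (circ a) = circ a"
    using circ_F3[OF a] by (simp_all add: psi_circ eval_nat_numeral)
  show ?thesis
    using arc[OF conv1] arc[OF conv2] arc[OF conv3] psi3 unfolding circ_F3[OF a]
    by (intro bexI[of _ "circ a"]) (simp_all add: psi2 psi_circ)
qed

text \<open>Here \<open>a\<close> and \<open>b\<close> represent \<open>u1\<close> and
  \<open>v1\<close>. The interval from \<open>b\<close> to \<open>F b\<close> contains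
  \<open>F a\<close>, so it belongs to \<open>u2\<close>; its second image belongs to
  \<open>u1\<close> after a full turn.\<close>

lemma hyperbolic_dynamics:
  assumes "norm B > \<bar>K\<bar>"
  shows "\<exists>u1\<in>circleS. (\<psi> ^^ 3) u1 = u1 \<and>
    (\<exists>v1\<in>ccw_arc u1 (\<psi> u1) - {u1, \<psi> u1}. (\<psi> ^^ 3) v1 = v1 \<and>
      (\<forall>v\<in>ccw_arc ((\<psi> ^^ 2) v1) v1 - {(\<psi> ^^ 2) v1, v1}. (\<lambda>n. (\<psi> ^^ (3*n)) v) \<longlonglongrightarrow> u1) \<and>
      (\<forall>v\<in>ccw_arc v1 (\<psi> v1) - {v1, \<psi> v1}. (\<lambda>n. (\<psi> ^^ (3*n)) v) \<longlonglongrightarrow> \<psi> u1) \<and>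
      (\<forall>v\<in>ccw_arc (\<psi> v1) ((\<psi> ^^ 2) v1) - {\<psi> v1, (\<psi> ^^ 2) v1}.
        (\<lambda>n. (\<psi> ^^ (3*n)) v) \<longlonglongrightarrow> (\<psi> ^^ 2) u1))"
proof -
  obtain a b where a: "ret a = a" and b: "ret b = b" and ab: "a < b" "b < F a"
    and conv1: "\<forall>v\<in>{b<..<F b}. (\<lambda>n. (ret ^^ n) v) \<longlonglongrightarrow> F a"
    using hyperbolic_case[OF assms] by auto
  then have conv2: "\<forall>v\<in>{F b<..<F (F b)}. (\<lambda>n. (ret ^^ n) v) \<longlonglongrightarrow> F (F a)"
    by (intro ballI basin_image[of "{F b<..<F (F b)}" "F a"]) auto
  then have conv3: "\<forall>v\<in>{F (F b)<..<F (F (F b))}. (\<lambda>n. (ret ^^ n) v) \<longlonglongrightarrow> F (F (F a))"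
    by (intro ballI basin_image[of "{F (F b)<..<F (F (F b))}" "F (F a)"]) auto
  have arc: "(\<lambda>n. (\<psi> ^^ (3*n)) v) \<longlonglongrightarrow> circ y"
    if conv: "\<forall>v\<in>{x<..<F x}. (\<lambda>n. (ret ^^ n) v) \<longlonglongrightarrow> y"
      and v: "v \<in> ccw_arc (circ x) (circ (F x)) - {circ x, circ (F x)}" for v x y
  proof -
    obtain s where "x \<le> s" "s \<le> F x" "v = circ s" "s \<noteq> x" "s \<noteq> F x"
      using v mem_ccw_arc_circ[of x "F x" v] greater[of x] F_less[of x] by auto
    then show ?thesis using conv psi_tendsto[of s y] by simp
  qed
  have psi2: "(\<psi> ^^ 2) (circ t) = circ (F (F t))" for t
    by (simp add: psi_circ eval_nat_numeral)
  have psi3: "(\<psi> ^^ 3) (circ a) = circ a" "(\<psi> ^^ 3) (circ b) = circ b"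
    using circ_F3[OF a] circ_F3[OF b] by (simp_all add: psi_circ eval_nat_numeral)
  have "circ b \<in> ccw_arc (circ a) (circ (F a))"
    unfolding mem_ccw_arc_circ[OF less_imp_le[OF greater] F_less] using ab by (intro exI[of _ b]) auto
  moreover have "circ b \<noteq> circ a" "circ b \<noteq> circ (F a)"
    using ab F_less[of a] circ_eq_imp_eq[of b a] circ_eq_imp_eq[of b "F a"] by auto
  ultimately have mem: "circ b \<in> ccw_arc (circ a) (circ (F a)) - {circ a, circ (F a)}" by simp
  show ?thesis
  proof (rule bexI[of _ "circ a"], rule conjI[OF psi3(1)], rule bexI[of _ "circ b"], intro conjI psi3)
    show "circ b \<in> ccw_arc (circ a) (\<psi> (circ a)) - {circ a, \<psi> (circ a)}"
      using mem by (simp only: psi_circ)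
    show "circ a \<in> circleS" by simp
    show "\<forall>v\<in>ccw_arc ((\<psi> ^^ 2) (circ b)) (circ b) - {(\<psi> ^^ 2) (circ b), circ b}.
      (\<lambda>n. (\<psi> ^^ (3*n)) v) \<longlonglongrightarrow> circ a"
      using arc[OF conv3] unfolding circ_F3[OF a] circ_F3[OF b] psi2 by blast
    show "\<forall>v\<in>ccw_arc (circ b) (\<psi> (circ b)) - {circ b, \<psi> (circ b)}.
      (\<lambda>n. (\<psi> ^^ (3*n)) v) \<longlonglongrightarrow> \<psi> (circ a)"
      using arc[OF conv1] unfolding psi_circ by blast
    show "\<forall>v\<in>ccw_arc (\<psi> (circ b)) ((\<psi> ^^ 2) (circ b)) - {\<psi> (circ b), (\<psi> ^^ 2) (circ b)}.
      (\<lambda>n. (\<psi> ^^ (3*n)) v) \<longlonglongrightarrow> (\<psi> ^^ 2) (circ a)"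
      using arc[OF conv2] unfolding psi_circ psi2 by blast
  qed
qed

end

section \<open>Choice of orientation and conclusion\<close>

theorem theorem4p4:
  fixes P Q R :: complex
  assumes "P \<in> diskD" "Q \<in> diskD" "R \<in> diskD"
    and "\<not> collinear {P, Q, R}"
    and "rotnum (tri_psi P Q R) = 1/3"
  shows
   "(delta P Q R = Deltaprime P Q \<longrightarrow>
      (\<exists>u1\<in>circleS. (tri_psi P Q R ^^ 3) u1 = u1 \<and>
        (let \<psi> = tri_psi P Q R; u2 = \<psi> u1; u3 = (\<psi> ^^ 2) u1 in
          (\<forall>v\<in>ccw_arc u3 u1 - {u3}. (\<lambda>n. (\<psi> ^^ (3*n)) v) \<longlonglongrightarrow> u1) \<and>
          (\<forall>v\<in>ccw_arc u1 u2 - {u1}. (\<lambda>n. (\<psi> ^^ (3*n)) v) \<longlonglongrightarrow> u2) \<and>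
          (\<forall>v\<in>ccw_arc u2 u3 - {u2}. (\<lambda>n. (\<psi> ^^ (3*n)) v) \<longlonglongrightarrow> u3))))
    \<and>
    (delta P Q R > Deltaprime P Q \<longrightarrow>
      (\<exists>u1\<in>circleS. (tri_psi P Q R ^^ 3) u1 = u1 \<and>
        (let \<psi> = tri_psi P Q R; u2 = \<psi> u1; u3 = (\<psi> ^^ 2) u1 in
          \<exists>v1\<in>ccw_arc u1 u2 - {u1, u2}. (\<psi> ^^ 3) v1 = v1 \<and>
            (let v2 = \<psi> v1; v3 = (\<psi> ^^ 2) v1 in
              (\<forall>v\<in>ccw_arc v3 v1 - {v3, v1}. (\<lambda>n. (\<psi> ^^ (3*n)) v) \<longlonglongrightarrow> u1) \<and>
              (\<forall>v\<in>ccw_arc v1 v2 - {v1, v2}. (\<lambda>n. (\<psi> ^^ (3*n)) v) \<longlonglongrightarrow> u2) \<and>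
              (\<forall>v\<in>ccw_arc v2 v3 - {v2, v3}. (\<lambda>n. (\<psi> ^^ (3*n)) v) \<longlonglongrightarrow> u3)))))"
proof -
  have D: "cross2 (Q - P) (R - P) \<noteq> 0" using assms(4) by (simp add: collinear_iff_cross2)
  then have "P \<noteq> Q" by (auto simp: cross2_eq)
  \<comment> \<open>Exchanging \<open>P\<close> and \<open>Q\<close> if necessary gives a
    counterclockwise triangle with the same vertices, hence the same map.\<close>
  define X Y where "X = (if cross2 (Q - P) (R - P) > 0 then P else Q)"
    and "Y = (if cross2 (Q - P) (R - P) > 0 then Q else P)"
  have flip: "cross2 (P - Q) (R - Q) = - cross2 (Q - P) (R - P)"
    by (simp add: cross2_eq algebra_simps)
  have XY: "X \<in> diskD" "Y \<in> diskD" using assms(1,2) by (simp_all add: X_def Y_def)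
  have ccw: "cross2 (Y - X) (R - X) > 0"
    using D by (cases "cross2 (Q - P) (R - P) > 0") (simp_all add: X_def Y_def flip)
  interpret ccw_triangle X Y R by (rule ccw_triangle.intro[OF XY assms(3) ccw])
  have "{P, Q, R} = {X, Y, R}" by (auto simp: X_def Y_def)
  then have psi: "tri_psi P Q R = \<psi>" by (simp add: tri_psi_def fun_eq_iff)
  \<comment> \<open>The exchange only flips the sign of the cross product, so the discriminant is
    unchanged and the distances stay those of \<open>P\<close>, \<open>Q\<close>, \<open>R\<close>
    in the given order.\<close>
  have disc: "(norm B)\<^sup>2 - K\<^sup>2 = (cross2 (Q - P) (R - P))\<^sup>2 - mink P P * mink Q Q * mink R R"
    unfolding discriminant by (simp add: X_def Y_def flip mult_ac)
  have par: "norm B = \<bar>K\<bar>" if "delta P Q R = Deltaprime P Q"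
  proof -
    have "(norm B)\<^sup>2 = K\<^sup>2"
      using disc delta_Deltaprime(1)[OF assms(1-3) \<open>P \<noteq> Q\<close> that] by simp
    then show ?thesis using power2_eq_iff_nonneg[of "norm B" "\<bar>K\<bar>"] by simp
  qed
  have hyp: "norm B > \<bar>K\<bar>" if "delta P Q R > Deltaprime P Q"
  proof -
    have "\<bar>K\<bar>\<^sup>2 < (norm B)\<^sup>2"
      using disc delta_Deltaprime(2)[OF assms(1-3) \<open>P \<noteq> Q\<close> that] by simp
    then show ?thesis by (rule power2_less_imp_less) simp
  qed
  show ?thesis unfolding Let_def psi
  proof (intro conjI impI)
    assume "delta P Q R = Deltaprime P Q"
    from parabolic_dynamics[OF par[OF this]] show "\<exists>u1\<in>circleS. (\<psi> ^^ 3) u1 = u1 \<and>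
      (\<forall>v\<in>ccw_arc ((\<psi> ^^ 2) u1) u1 - {(\<psi> ^^ 2) u1}. (\<lambda>n. (\<psi> ^^ (3*n)) v) \<longlonglongrightarrow> u1) \<and>
      (\<forall>v\<in>ccw_arc u1 (\<psi> u1) - {u1}. (\<lambda>n. (\<psi> ^^ (3*n)) v) \<longlonglongrightarrow> \<psi> u1) \<and>
      (\<forall>v\<in>ccw_arc (\<psi> u1) ((\<psi> ^^ 2) u1) - {\<psi> u1}. (\<lambda>n. (\<psi> ^^ (3*n)) v) \<longlonglongrightarrow> (\<psi> ^^ 2) u1)" .
  qed (rule hyperbolic_dynamics[OF hyp])
qed

end
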